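(* Let $\Gamma$ be a balanced graph containing $v_0$ vertices and $e_0$ edges, and suppose the number of colours is $r = n^{\theta}$ and the edge probability is $p = \frac{1}{n^{\beta}}$ for some constants $0 < \theta <1$ and $\frac{1}{e_0} < \beta < \frac{v_0}{e_0}$, so that $\theta_{th} := \frac{v_0-e_0\beta}{v_0-1}$ satisfies $0<\theta_{th}<1$. Let $G$ be the random graph on $n$ vertices with edge probability $p$ and i.i.d. edge weights as described in the context, and for $M>0$ let $N_{tot}$ and $N_{good}=N_{good}(M)$ denote respectively the total number of colourings of $G$ and the number of good colourings of $G$. There exists a constant $M_0>0$ such that for every constant $M > M_0$ the following hold: (a) If $\theta < \theta_{th}$, then there are constants $C_1,C_2>0$ (not depending on $n$) such that for all sufficiently large $n$, $$\mathbb{P}\left(N_{good} \geq N_{tot}\left(1-\frac{1}{n^{C_1}}\right)\right) \geq 1- \frac{1}{n^{C_2}}.$$ (b) If $\theta > \theta_{th}$, then there are constants $D_1,D_2>0$ (not depending on $n$) such that for all sufficiently large $n$, $$\mathbb{P}\left(N_{good} \leq \frac{N_{tot}}{n^{D_1}}\right) \geq 1- \frac{1}{n^{D_2}}.$$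
   Context: Random graph and weights: Let $K_n$ be the complete graph on $n$ vertices. Let $\{X_h\}$, indexed by the edges $h$ of $K_n$, be i.i.d. Bernoulli random variables with $\mathbb{P}(X_h=1)=p=1-\mathbb{P}(X_h=0)$. The edges of $K_n$ are also equipped with i.i.d. real-valued random weights $\{w(h)\}$, independent of $\{X_h\}$, with $w(h)\ge 1$ almost surely; the common law of the weights does not depend on $n$. $\mathbb{P}$ denotes the joint probability measure of $\{X_h\}$ and $\{w(h)\}$. The random graph $G$ is the subgraph of $K_n$ (on all $n$ vertices) consisting of all edges $h$ with $X_h=1$. For an edge $h=(u,v)$ write $w(u,v)=w(h)$. Balanced graphs and copies: $\Gamma$ is a fixed (deterministic, labelled, not depending on $n$) graph with $v_0$ vertices and $e_0$ edges. It is balanced if for every subgraph $H\subset\Gamma$ one has $\frac{e(H)}{v(H)}\le\frac{e_0}{v_0}$, where $e(H)$ and $v(H)$ are the numbers of edges and vertices of $H$. A subgraph $T\subset G$ with $v_0$ vertices and $e_0$ edges is a copy of $\Gamma$ if it is isomorphic to $\Gamma$, i.e. there is a bijection $g:V(T)\to V(\Gamma)$ such that $(u,v)\in E(T)$ if and only if $(g(u),g(v))\in E(\Gamma)$ (copies need not be induced). Colourings: A colouring of $G$ is any map $\phi$ from the vertex set of $G$ to $\{1,2,\ldots,r\}$ (so $N_{tot}=r^n$), where $r=n^{\theta}$ is understood as an integer (rounded if necessary). Given a colouring $\phi$ and a constant $M>0$, a subgraph $T\subset G$ is $M$-good (or simply good) if $$w(u,v)\le|\phi(u)-\phi(v)|\le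 M\quad\text{for every edge }(u,v)\in E(T).$$ The colouring $\phi$ is good if there is at least one good copy of $\Gamma$ in $G$. Since $G$ and the weights are random, $N_{good}$ is a random variable.
   Formalization: Part (b) is stated only for connected Γ: for disconnected balanced Γ it fails just above θ_th (e.g. two disjoint edges, β=1.5, θ=0.4, w=1). Where (b) does hold for disconnected Γ, it follows by applying it to a largest component. *)

theory Defs
  imports "HOL-Probability.Probability"
begin

text \<open>A graph is a pair of a vertex set and a set of two-element subsets of it.\<close>

type_synonym 'a graph = "'a set \<times> 'a set set"

abbreviation verts :: "'a graph \<Rightarrow> 'a set" where "verts \<equiv> fst"
abbreviation edges :: "'a graph \<Rightarrow> 'a set set" where "edges \<equiv> snd"

definition all_edges :: "'a set \<Rightarrow> 'a set set" where
  "all_edges V = {e. e \<subseteq> V \<and> card e = 2}"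

definition finite_graph :: "'a graph \<Rightarrow> bool" where
  "finite_graph G \<longleftrightarrow> finite (verts G) \<and> edges G \<subseteq> all_edges (verts G)"

definition subgraph :: "'a graph \<Rightarrow> 'a graph \<Rightarrow> bool" where
  "subgraph H G \<longleftrightarrow> finite_graph H \<and> verts H \<subseteq> verts G \<and> edges H \<subseteq> edges G"

definition balanced :: "'a graph \<Rightarrow> bool" where
  "balanced \<Gamma> \<longleftrightarrow>
     (\<forall>H. subgraph H \<Gamma> \<and> verts H \<noteq> {} \<longrightarrow>
        real (card (edges H)) / real (card (verts H))
          \<le> real (card (edges \<Gamma>)) / real (card (verts \<Gamma>)))"

text \<open>
  Needed for the upper bound on the number of good colourings only. For a balanced disconnected
  \<open>\<Gamma>\<close> the components of a copy can be coloured far apart, good copies persist for \<open>\<theta>\<close> slightly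
  above \<open>(v0 - e0 * \<beta>) / (v0 - 1)\<close>, and that bound fails.
\<close>

definition connected_graph :: "'a graph \<Rightarrow> bool" where
  "connected_graph G \<longleftrightarrow>
     verts G \<noteq> {} \<and>
     (\<forall>u\<in>verts G. \<forall>v\<in>verts G. (u, v) \<in> {(x, y). {x, y} \<in> edges G}\<^sup>*)"

definition graph_iso :: "'a graph \<Rightarrow> 'b graph \<Rightarrow> bool" where
  "graph_iso T \<Gamma> \<longleftrightarrow>
     (\<exists>g. bij_betw g (verts T) (verts \<Gamma>) \<and>
          (\<forall>u\<in>verts T. \<forall>v\<in>verts T. {u, v} \<in> edges T \<longleftrightarrow> {g u, g v} \<in> edges \<Gamma>))"

text \<open>Copies need not be induced subgraphs of the host graph.\<close>

definition is_copy :: "'a graph \<Rightarrow> 'b graph \<Rightarrow> 'a graph \<Rightarrow> bool" where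
  "is_copy T \<Gamma> G \<longleftrightarrow>
     subgraph T G \<and> card (verts T) = card (verts \<Gamma>) \<and> card (edges T) = card (edges \<Gamma>) \<and>
     graph_iso T \<Gamma>"

definition colourings :: "'a set \<Rightarrow> nat \<Rightarrow> ('a \<Rightarrow> nat) set" where
  "colourings V r = V \<rightarrow>\<^sub>E {1..r}"

definition good_subgraph :: "real \<Rightarrow> ('a set \<Rightarrow> real) \<Rightarrow> ('a \<Rightarrow> nat) \<Rightarrow> 'a graph \<Rightarrow> bool" where
  "good_subgraph M w \<phi> T \<longleftrightarrow>
     (\<forall>u v. {u, v} \<in> edges T \<longrightarrow>
        w {u, v} \<le> \<bar>real (\<phi> u) - real (\<phi> v)\<bar> \<and> \<bar>real (\<phi> u) - real (\<phi> v)\<bar> \<le> M)"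

definition good_colouring ::
  "'b graph \<Rightarrow> real \<Rightarrow> 'a graph \<Rightarrow> ('a set \<Rightarrow> real) \<Rightarrow> ('a \<Rightarrow> nat) \<Rightarrow> bool" where
  "good_colouring \<Gamma> M G w \<phi> \<longleftrightarrow> (\<exists>T. is_copy T \<Gamma> G \<and> good_subgraph M w \<phi> T)"

definition N_tot :: "'a graph \<Rightarrow> nat \<Rightarrow> nat" where
  "N_tot G r = card (colourings (verts G) r)"

definition N_good :: "'b graph \<Rightarrow> real \<Rightarrow> nat \<Rightarrow> 'a graph \<Rightarrow> ('a set \<Rightarrow> real) \<Rightarrow> nat" where
  "N_good \<Gamma> M r G w = card {\<phi> \<in> colourings (verts G) r. good_colouring \<Gamma> M G w \<phi>}"

abbreviation K_edges :: "nat \<Rightarrow> nat set set" where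
  "K_edges n \<equiv> all_edges {..<n}"

definition open_graph :: "nat \<Rightarrow> (nat set \<Rightarrow> real) \<Rightarrow> nat graph" where
  "open_graph n x = ({..<n}, {h \<in> K_edges n. x h = 1})"

text \<open>
  \<open>weighted_edges \<Omega> n p W X w\<close>: on the probability space \<open>\<Omega>\<close> the edges of the complete graph
  on \<open>n\<close> vertices carry Bernoulli(\<open>p\<close>) variables \<open>X h\<close> and weights \<open>w h\<close> of common law \<open>W\<close>.
  Independence is imposed on the disjoint union of the two families, so that the \<open>X h\<close> are
  independent, the \<open>w h\<close> are independent, and the two families are independent of each other.
\<close>

definition weighted_edges ::
  "'s measure \<Rightarrow> nat \<Rightarrow> real \<Rightarrow> real measure \<Rightarrow>
   (nat set \<Rightarrow> 's \<Rightarrow> real) \<Rightarrow> (nat set \<Rightarrow> 's \<Rightarrow> real) \<Rightarrow> bool" where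
  "weighted_edges \<Omega> n p W X w \<longleftrightarrow>
     prob_space \<Omega> \<and>
     prob_space.indep_vars \<Omega> (\<lambda>_. borel) (case_sum X w) (K_edges n <+> K_edges n) \<and>
     (\<forall>h\<in>K_edges n.
        \<P>(\<omega> in \<Omega>. X h \<omega> = 1) = p \<and> \<P>(\<omega> in \<Omega>. X h \<omega> = 0) = 1 - p \<and>
        distr \<Omega> borel (w h) = W \<and> (AE \<omega> in \<Omega>. 1 \<le> w h \<omega>))"

end

theory Submission
  imports Defs
begin

text \<open>
  Part (b) is a first moment bound: connectedness confines the colours of a good copy to a window of
  bounded width, so a uniformly random colouring has about \<open>n powr (v0 - e0 * \<beta> - \<theta> * (v0 - 1))\<close>
  good copies in expectation. Part (a) is a second moment bound, taken jointly over the random graph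
  and a uniformly random colouring. Only special copies are counted: the \<open>n\<close> vertices are cut into
  \<open>v0\<close> blocks, the \<open>i\<close>-th vertex of \<open>\<Gamma>\<close> is placed in the \<open>i\<close>-th block and coloured \<open>c + L * i\<close>, and
  the edges have weight at most \<open>L\<close>, where \<open>L\<close> is such that this has positive probability. Two such
  copies sharing \<open>s \<ge> 1\<close> vertices have the same base colour \<open>c\<close> and share at most \<open>e0 * s / v0\<close> edges
  because \<open>\<Gamma>\<close> is balanced; the exponent of their contribution relative to the squared mean is linear
  in \<open>s\<close> and negative at both \<open>s = 1\<close> and \<open>s = v0\<close>. In both parts Markov's inequality passes from the
  expected number of colourings to a bound with high probability.
\<close>

section \<open>Moment inequalities for counting colourings\<close>

text \<open>
  Chebyshev's inequality for the number of \<open>j\<close> with \<open>\<phi> \<in> B j\<close> and \<open>\<omega> \<in> F j\<close>, where \<open>\<phi>\<close> is uniform on \<open>\<Phi>\<close>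
  and independent of \<open>\<omega>\<close>; \<open>\<mu>\<close> is the mean of that number.
\<close>

lemma (in prob_space) second_moment_count:
  fixes \<Phi> :: "'c set" and J :: "'j set" and B :: "'j \<Rightarrow> 'c set" and F :: "'j \<Rightarrow> 'a set"
  assumes fin: "finite \<Phi>" "\<Phi> \<noteq> {}" "finite J"
    and F: "\<And>j. j \<in> J \<Longrightarrow> F j \<in> events"
    and \<mu>: "\<mu> = (\<Sum>j\<in>J. real (card (\<Phi> \<inter> B j)) / card \<Phi> * prob (F j))"
  shows "\<mu>\<^sup>2 * expectation (\<lambda>\<omega>. real (card {\<phi>\<in>\<Phi>. \<forall>j\<in>J. \<phi> \<in> B j \<longrightarrow> \<omega> \<notin> F j}))
    \<le> card \<Phi> * ((\<Sum>j\<in>J. \<Sum>k\<in>J. real (card (\<Phi> \<inter> (B j \<inter> B k))) / card \<Phi> * prob (F j \<inter> F k)) - \<mu>\<^sup>2)"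
proof -
  define N :: "'c \<Rightarrow> 'a \<Rightarrow> real"
    where "N \<phi> \<omega> = (\<Sum>j\<in>J. indicator (B j) \<phi> * indicator (F j) \<omega>)" for \<phi> \<omega>
  define bad where "bad \<omega> = {\<phi>\<in>\<Phi>. \<forall>j\<in>J. \<phi> \<in> B j \<longrightarrow> \<omega> \<notin> F j}" for \<omega>
  have card\<Phi>: "real (card \<Phi>) > 0"
    using fin by (simp add: card_gt_0_iff)
  have card_ind: "(\<Sum>\<phi>\<in>\<Phi>. indicator A \<phi>) = real (card (\<Phi> \<inter> A))" for A :: "'c set"
    using fin(1) by (simp add: indicator_def sum.If_cases)
  have int1: "integrable M (\<lambda>\<omega>. indicator (F j) \<omega> :: real)" if "j \<in> J" for j
    using F[OF that] by (simp add: less_top[symmetric])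
  have int2: "integrable M (\<lambda>\<omega>. indicator (F j \<inter> F k) \<omega> :: real)" if "j \<in> J" "k \<in> J" for j k
    using F[OF that(1)] F[OF that(2)] by (simp add: less_top[symmetric])
  have expand: "(N \<phi> \<omega> - \<mu>)\<^sup>2 =
      (\<Sum>j\<in>J. \<Sum>k\<in>J. indicator (B j \<inter> B k) \<phi> * indicator (F j \<inter> F k) \<omega>)
        - 2 * \<mu> * (\<Sum>j\<in>J. indicator (B j) \<phi> * indicator (F j) \<omega>) + \<mu>\<^sup>2" for \<phi> \<omega>
    unfolding N_def power2_diff
    by (simp add: power2_eq_square sum_product indicator_inter_arith mult_ac)
  have int_sq: "integrable M (\<lambda>\<omega>. (N \<phi> \<omega> - \<mu>)\<^sup>2)" for \<phi>
    unfolding expand using int1 int2 by (auto intro!: Bochner_Integration.integrable_add Bochner_Integration.integrable_diff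
        Bochner_Integration.integrable_sum integrable_mult_right)
  have exp_sq: "expectation (\<lambda>\<omega>. (N \<phi> \<omega> - \<mu>)\<^sup>2) =
      (\<Sum>j\<in>J. \<Sum>k\<in>J. indicator (B j \<inter> B k) \<phi> * prob (F j \<inter> F k))
        - 2 * \<mu> * (\<Sum>j\<in>J. indicator (B j) \<phi> * prob (F j)) + \<mu>\<^sup>2" for \<phi>
  proof -
    have "expectation (\<lambda>\<omega>. indicator (F j) \<omega>) = prob (F j)" if "j \<in> J" for j
      using F[OF that] by simp
    moreover have "expectation (\<lambda>\<omega>. indicator (F j \<inter> F k) \<omega>) = prob (F j \<inter> F k)"
      if "j \<in> J" "k \<in> J" for j k
      using F[OF that(1)] F[OF that(2)] by simp
    ultimately show ?thesis
      unfolding expand using int1 int2 by (simp add: Bochner_Integration.integral_sum prob_space)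
  qed
  \<comment> \<open>A bad colouring has \<open>N \<phi> \<omega> = 0\<close>, so it alone
    contributes \<open>\<mu>\<^sup>2\<close> to the sum of squared deviations.\<close>
  have mono: "\<mu>\<^sup>2 * real (card (bad \<omega>)) \<le> (\<Sum>\<phi>\<in>\<Phi>. (N \<phi> \<omega> - \<mu>)\<^sup>2)" for \<omega>
  proof -
    have "N \<phi> \<omega> = 0" if "\<phi> \<in> bad \<omega>" for \<phi>
      using that by (auto simp: N_def bad_def indicator_def intro!: sum.neutral)
    then have "\<mu>\<^sup>2 * real (card (bad \<omega>)) = (\<Sum>\<phi>\<in>bad \<omega>. (N \<phi> \<omega> - \<mu>)\<^sup>2)"
      by simp
    also have "\<dots> \<le> (\<Sum>\<phi>\<in>\<Phi>. (N \<phi> \<omega> - \<mu>)\<^sup>2)"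
      using fin(1) by (intro sum_mono2) (auto simp: bad_def)
    finally show ?thesis .
  qed
  have "\<mu>\<^sup>2 * expectation (\<lambda>\<omega>. real (card (bad \<omega>))) = expectation (\<lambda>\<omega>. \<mu>\<^sup>2 * real (card (bad \<omega>)))"
    by simp
  also have "\<dots> \<le> expectation (\<lambda>\<omega>. \<Sum>\<phi>\<in>\<Phi>. (N \<phi> \<omega> - \<mu>)\<^sup>2)"
    using int_sq mono by (intro integral_mono') (auto simp: sum_nonneg)
  also have "\<dots> = (\<Sum>\<phi>\<in>\<Phi>. expectation (\<lambda>\<omega>. (N \<phi> \<omega> - \<mu>)\<^sup>2))"
    using int_sq by simp
  also have "\<dots> = (\<Sum>j\<in>J. \<Sum>k\<in>J. (\<Sum>\<phi>\<in>\<Phi>. indicator (B j \<inter> B k) \<phi>) * prob (F j \<inter> F k))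
        - 2 * \<mu> * (\<Sum>j\<in>J. (\<Sum>\<phi>\<in>\<Phi>. indicator (B j) \<phi>) * prob (F j)) + card \<Phi> * \<mu>\<^sup>2"
    unfolding exp_sq sum.distrib sum_subtractf sum_distrib_left[symmetric] sum_distrib_right
    by (simp add: sum.swap[of _ J \<Phi>])
  also have "(\<Sum>j\<in>J. (\<Sum>\<phi>\<in>\<Phi>. indicator (B j) \<phi>) * prob (F j)) = card \<Phi> * \<mu>"
    unfolding card_ind \<mu> sum_distrib_left using card\<Phi> by simp
  also have "(\<Sum>j\<in>J. \<Sum>k\<in>J. (\<Sum>\<phi>\<in>\<Phi>. indicator (B j \<inter> B k) \<phi>) * prob (F j \<inter> F k))
      = card \<Phi> * (\<Sum>j\<in>J. \<Sum>k\<in>J. real (card (\<Phi> \<inter> (B j \<inter> B k))) / card \<Phi> * prob (F j \<inter> F k))"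
    unfolding card_ind sum_distrib_left using card\<Phi> by simp
  finally show ?thesis
    unfolding bad_def by (simp add: algebra_simps power2_eq_square)
qed

text \<open>Markov's inequality at level \<open>t * \<epsilon>\<close>. Here \<open>t\<close> will
  be the total number of colourings. The square in the hypothesis lets a single
  \<open>\<epsilon>\<close> serve both as the exceptional proportion of colourings and as the
  failure probability.\<close>

lemma (in prob_space) markov_lower_tail:
  assumes "integrable M Y" "\<And>\<omega>. \<omega> \<in> space M \<Longrightarrow> 0 \<le> Y \<omega>"
    and "0 < \<epsilon>" "0 < t" "expectation Y \<le> t * \<epsilon>\<^sup>2"
  shows "prob {\<omega> \<in> space M. Y \<omega> \<le> t * \<epsilon>} \<ge> 1 - \<epsilon>"
proof -
  have [measurable]: "Y \<in> borel_measurable M"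
    using assms(1) by auto
  have "prob {\<omega> \<in> space M. Y \<omega> \<ge> t * \<epsilon>} \<le> expectation Y / (t * \<epsilon>)"
    using assms by (intro integral_Markov_inequality_measure[where A = "{}"]) auto
  also have "\<dots> \<le> t * \<epsilon>\<^sup>2 / (t * \<epsilon>)"
    using assms by (intro divide_right_mono) auto
  also have "\<dots> = \<epsilon>"
    using assms by (simp add: power2_eq_square)
  finally have "prob {\<omega> \<in> space M. Y \<omega> \<ge> t * \<epsilon>} \<le> \<epsilon>" .
  moreover have "1 \<le> prob {\<omega> \<in> space M. Y \<omega> \<le> t * \<epsilon>} + prob {\<omega> \<in> space M. Y \<omega> \<ge> t * \<epsilon>}"
  proof -
    have "1 = prob ({\<omega> \<in> space M. Y \<omega> \<le> t * \<epsilon>} \<union> {\<omega> \<in> space M. Y \<omega> \<ge> t * \<epsilon>})"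
      by (subst prob_space[symmetric], rule arg_cong[where f = prob]) auto
    also have "\<dots> \<le> prob {\<omega> \<in> space M. Y \<omega> \<le> t * \<epsilon>} + prob {\<omega> \<in> space M. Y \<omega> \<ge> t * \<epsilon>}"
      by (intro measure_Un_le) auto
    finally show ?thesis .
  qed
  ultimately show ?thesis by linarith
qed

section \<open>Product counts, probabilities of edge events, and measurability of the number of good
  colourings\<close>

lemma card_PiE_if:
  assumes "finite V" "S \<subseteq> V"
  shows "card (\<Pi>\<^sub>E x\<in>V. if x \<in> S then A x else B) = (\<Prod>x\<in>S. card (A x)) * card B ^ (card V - card S)"
proof -
  have "card (\<Pi>\<^sub>E x\<in>V. if x \<in> S then A x else B) = (\<Prod>x\<in>V. if x \<in> S then card (A x) else card B)"
    using assms by (simp add: card_PiE if_distrib)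
  also have "\<dots> = (\<Prod>x\<in>S. card (A x)) * (\<Prod>x\<in>V - S. card B)"
    using assms by (simp add: prod.If_cases Int_absorb1 Diff_eq)
  finally show ?thesis
    using assms by (simp add: card_Diff_subset finite_subset)
qed

lemma finite_all_edges: "finite V \<Longrightarrow> finite (all_edges V)"
  unfolding all_edges_def by (rule finite_subset[of _ "Pow V"]) auto

text \<open>The event is an intersection of preimages over the index set \<open>E <+> E\<close>, so
  independence on the disjoint union of the two families factors it. \<open>A = UNIV\<close> is the
  choice for the first moment, \<open>A = {..real L}\<close> the one for the second.\<close>

lemma weighted_edges_prob:
  assumes we: "weighted_edges \<Omega> n p W X w" and E: "E \<subseteq> K_edges n" and A: "A \<in> sets borel"
  shows "\<P>(\<omega> in \<Omega>. \<forall>h\<in>E. X h \<omega> = 1 \<and> w h \<omega> \<in> A) = (p * measure W A) ^ card E"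
    and "{\<omega> \<in> space \<Omega>. \<forall>h\<in>E. X h \<omega> = 1 \<and> w h \<omega> \<in> A} \<in> sets \<Omega>"
proof -
  interpret prob_space \<Omega>
    using we by (simp add: weighted_edges_def)
  have finE: "finite E"
    using E finite_all_edges[of "{..<n}"] finite_subset by blast
  have indep: "indep_vars (\<lambda>_. borel) (case_sum X w) (K_edges n <+> K_edges n)"
    using we by (simp add: weighted_edges_def)
  have rv: "case_sum X w z \<in> borel_measurable \<Omega>" if "z \<in> K_edges n <+> K_edges n" for z
    using indep that by (auto simp: indep_vars_def)
  have X: "X h \<in> borel_measurable \<Omega>" and w: "w h \<in> borel_measurable \<Omega>" if "h \<in> E" for h
    using rv[of "Inl h"] rv[of "Inr h"] that E by auto
  show "{\<omega> \<in> space \<Omega>. \<forall>h\<in>E. X h \<omega> = 1 \<and> w h \<omega> \<in> A} \<in> sets \<Omega>"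
    using X w A finE by (intro sets.sets_Collect_finite_All sets.sets_Collect_conj) auto
  show "\<P>(\<omega> in \<Omega>. \<forall>h\<in>E. X h \<omega> = 1 \<and> w h \<omega> \<in> A) = (p * measure W A) ^ card E"
  proof (cases "E = {}")
    \<comment> \<open>The product formula for independent variables asks for a nonempty index
      set.\<close>
    case True
    then show ?thesis by (simp add: prob_space)
  next
    case False
    define Q :: "nat set + nat set \<Rightarrow> real set" where "Q = case_sum (\<lambda>_. {1}) (\<lambda>_. A)"
    have "{\<omega> \<in> space \<Omega>. \<forall>h\<in>E. X h \<omega> = 1 \<and> w h \<omega> \<in> A} =
        (\<Inter>z\<in>E <+> E. case_sum X w z -` Q z \<inter> space \<Omega>)"
      using False by (auto simp: Q_def Plus_def ball_Un)
    also have "prob \<dots> = (\<Prod>z\<in>E <+> E. prob (case_sum X w z -` Q z \<inter> space \<Omega>))"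
      using indep False finE E A by (intro indep_varsD[OF indep]) (auto simp: Q_def)
    also have "\<dots> = (\<Prod>h\<in>E. prob (X h -` {1} \<inter> space \<Omega>)) * (\<Prod>h\<in>E. prob (w h -` A \<inter> space \<Omega>))"
      using finE by (simp add: prod.Plus Q_def)
    also have "(\<Prod>h\<in>E. prob (X h -` {1} \<inter> space \<Omega>)) = p ^ card E"
    proof -
      have "prob (X h -` {1} \<inter> space \<Omega>) = p" if "h \<in> E" for h
      proof -
        have "X h -` {1} \<inter> space \<Omega> = {\<omega> \<in> space \<Omega>. X h \<omega> = 1}" by auto
        then show ?thesis using we that E by (auto simp: weighted_edges_def)
      qed
      then show ?thesis by simp
    qed
    also have "(\<Prod>h\<in>E. prob (w h -` A \<inter> space \<Omega>)) = measure W A ^ card E"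
    proof -
      have "prob (w h -` A \<inter> space \<Omega>) = measure W A" if "h \<in> E" for h
        using we that E A w[OF that] by (auto simp: weighted_edges_def measure_distr[symmetric])
      then show ?thesis by simp
    qed
    finally show ?thesis by (simp add: power_mult_distrib)
  qed
qed

text \<open>\<open>W\<close> is tied to the model only as the law of an edge weight, so its
  properties are read off an actual edge; \<open>2 \<le> n\<close> supplies the edge
  \<open>{0, 1}\<close>.\<close>

lemma weighted_edges_law:
  assumes "weighted_edges \<Omega> n p W X w" "2 \<le> n"
  shows "prob_space W" "sets W = sets borel"
proof -
  interpret prob_space \<Omega>
    using assms by (simp add: weighted_edges_def)
  have h: "{0, 1} \<in> K_edges n"
    using assms(2) by (auto simp: all_edges_def)
  then have W: "W = distr \<Omega> borel (w {0, 1})"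
    using assms(1) by (auto simp: weighted_edges_def)
  have "case_sum X w z \<in> borel_measurable \<Omega>" if "z \<in> K_edges n <+> K_edges n" for z
    using assms(1) that unfolding weighted_edges_def by (auto simp: indep_vars_def)
  from this[of "Inr {0, 1}"] have "w {0, 1} \<in> borel_measurable \<Omega>"
    using h by auto
  then show "prob_space W" "sets W = sets borel"
    by (auto simp: W intro!: prob_space_distr)
qed

text \<open>For fixed \<open>\<phi>\<close> only finitely many candidate copies exist, namely those
  in the complete graph, so the event is a finite combination of conditions on single edges.\<close>

lemma good_colouring_measurable:
  assumes we: "weighted_edges \<Omega> n p W X w"
  shows "{\<omega> \<in> space \<Omega>. good_colouring \<Gamma> M (open_graph n (\<lambda>h. X h \<omega>)) (\<lambda>h. w h \<omega>) \<phi>} \<in> sets \<Omega>"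
proof -
  interpret prob_space \<Omega>
    using we by (simp add: weighted_edges_def)
  have rv: "case_sum X w z \<in> borel_measurable \<Omega>" if "z \<in> K_edges n <+> K_edges n" for z
    using we that unfolding weighted_edges_def by (auto simp: indep_vars_def)
  have X: "X h \<in> borel_measurable \<Omega>" and w: "w h \<in> borel_measurable \<Omega>" if "h \<in> K_edges n" for h
    using rv[of "Inl h"] rv[of "Inr h"] that by auto
  define \<T> where "\<T> = {T. is_copy T \<Gamma> ({..<n}, K_edges n)}"
  have "\<T> \<subseteq> Pow {..<n} \<times> Pow (K_edges n)"
    by (auto simp: \<T>_def is_copy_def subgraph_def)
  then have fin: "finite \<T>"
    using finite_all_edges[of "{..<n}"] by (auto intro: finite_subset)
  \<comment> \<open>The quantifier over copies in the random graph becomes one over the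
    deterministic finite set \<open>\<T>\<close>, and endpoints range over the finite edge
    \<open>h\<close> instead of the whole vertex type.\<close>
  have eq: "{\<omega> \<in> space \<Omega>. good_colouring \<Gamma> M (open_graph n (\<lambda>h. X h \<omega>)) (\<lambda>h. w h \<omega>) \<phi>} =
    {\<omega> \<in> space \<Omega>. \<exists>T\<in>\<T>. \<forall>h\<in>edges T. X h \<omega> = 1 \<and>
        (\<forall>u\<in>h. \<forall>v\<in>h. h = {u, v} \<longrightarrow> w h \<omega> \<le> \<bar>real (\<phi> u) - real (\<phi> v)\<bar> \<and> \<bar>real (\<phi> u) - real (\<phi> v)\<bar> \<le> M)}"
  proof -
    have sub: "is_copy T \<Gamma> (open_graph n x) \<longleftrightarrow> T \<in> \<T> \<and> (\<forall>h\<in>edges T. x h = 1)" for T x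
      by (auto simp: is_copy_def subgraph_def open_graph_def \<T>_def)
    have good: "good_subgraph M w' \<phi> T \<longleftrightarrow> (\<forall>h\<in>edges T. \<forall>u\<in>h. \<forall>v\<in>h. h = {u, v} \<longrightarrow>
        w' h \<le> \<bar>real (\<phi> u) - real (\<phi> v)\<bar> \<and> \<bar>real (\<phi> u) - real (\<phi> v)\<bar> \<le> M)" for T w'
      unfolding good_subgraph_def
    proof (intro iffI ballI allI impI)
      fix u v
      assume *: "\<forall>h\<in>edges T. \<forall>u\<in>h. \<forall>v\<in>h. h = {u, v} \<longrightarrow>
        w' h \<le> \<bar>real (\<phi> u) - real (\<phi> v)\<bar> \<and> \<bar>real (\<phi> u) - real (\<phi> v)\<bar> \<le> M" and "{u, v} \<in> edges T"
      from bspec[OF this] show "w' {u, v} \<le> \<bar>real (\<phi> u) - real (\<phi> v)\<bar> \<and> \<bar>real (\<phi> u) - real (\<phi> v)\<bar> \<le> M"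
        by simp
    qed simp
    show ?thesis
      unfolding good_colouring_def sub good by (simp only: Bex_def ball_conj_distrib conj_assoc)
  qed
  have edgesT: "h \<in> K_edges n" if "T \<in> \<T>" "h \<in> edges T" for T h
    using that by (auto simp: \<T>_def is_copy_def subgraph_def)
  have finh: "finite h" if "T \<in> \<T>" "h \<in> edges T" for T h
    using edgesT[OF that] by (auto simp: all_edges_def intro: finite_subset)
  have finT: "finite (edges T)" if "T \<in> \<T>" for T
    using edgesT[OF that] finite_all_edges[of "{..<n}"] by (meson finite_subset finite_lessThan subsetI)
  show ?thesis
    unfolding eq
    using fin finT finh edgesT X w
    by (intro sets.sets_Collect_finite_Ex sets.sets_Collect_finite_All sets.sets_Collect_conj
        sets.sets_Collect_imp sets.sets_Collect_const) auto
qed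

lemma N_good_eq_sum:
  assumes "finite (verts H)"
  shows "real (N_good \<Gamma> M r H w) =
    (\<Sum>\<phi>\<in>colourings (verts H) r. if good_colouring \<Gamma> M H w \<phi> then 1 else 0)"
proof -
  have "finite (colourings (verts H) r)"
    using assms by (simp add: colourings_def finite_PiE)
  then show ?thesis
    by (simp add: N_good_def sum.If_cases Int_def)
qed

lemma N_good_le_N_tot:
  assumes "finite (verts H)"
  shows "N_good \<Gamma> M r H w \<le> N_tot H r"
  unfolding N_good_def N_tot_def
  using assms by (intro card_mono) (auto simp: colourings_def finite_PiE)

lemma N_good_integrable:
  assumes we: "weighted_edges \<Omega> n p W X w"
  shows "integrable \<Omega> (\<lambda>\<omega>. real (N_good \<Gamma> M r (open_graph n (\<lambda>h. X h \<omega>)) (\<lambda>h. w h \<omega>)))"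
proof -
  interpret prob_space \<Omega>
    using we by (simp add: weighted_edges_def)
  have "(\<lambda>\<omega>. real (N_good \<Gamma> M r (open_graph n (\<lambda>h. X h \<omega>)) (\<lambda>h. w h \<omega>))) =
     (\<lambda>\<omega>. \<Sum>\<phi>\<in>colourings {..<n} r.
       if good_colouring \<Gamma> M (open_graph n (\<lambda>h. X h \<omega>)) (\<lambda>h. w h \<omega>) \<phi> then 1 else 0)"
    by (subst N_good_eq_sum) (simp_all add: open_graph_def)
  then have "(\<lambda>\<omega>. real (N_good \<Gamma> M r (open_graph n (\<lambda>h. X h \<omega>)) (\<lambda>h. w h \<omega>))) \<in> borel_measurable \<Omega>"
    using good_colouring_measurable[OF we, of \<Gamma> M]
    by (auto intro!: borel_measurable_sum measurable_If simp: pred_def)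
  moreover have "real (N_good \<Gamma> M r (open_graph n (\<lambda>h. X h \<omega>)) (\<lambda>h. w h \<omega>)) \<le> card (colourings {..<n} r)" for \<omega>
    using N_good_le_N_tot[of "open_graph n (\<lambda>h. X h \<omega>)" \<Gamma> M r "\<lambda>h. w h \<omega>"]
    by (simp add: N_tot_def open_graph_def)
  ultimately show ?thesis
    by (intro integrable_const_bound[where B = "card (colourings {..<n} r)"]) auto
qed

section \<open>Copies of the fixed graph as injective embeddings\<close>

lemma finite_graph_edgeD:
  assumes "finite_graph \<Gamma>" "e \<in> edges \<Gamma>"
  shows "e \<subseteq> verts \<Gamma>" "card e = 2" "finite e"
  using assms by (auto simp: finite_graph_def all_edges_def intro: finite_subset)

lemma inj_on_image_edges:
  assumes "finite_graph \<Gamma>" "inj_on f (verts \<Gamma>)"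
  shows "inj_on ((`) f) (edges \<Gamma>)"
  using assms finite_graph_edgeD(1)[OF assms(1)] by (auto simp: inj_on_def inj_on_image_eq_iff)

text \<open>The image of \<open>\<Gamma>\<close> under \<open>f\<close> is the copy, and the inverse
  of \<open>f\<close> is the isomorphism. All conditions are stated on \<open>\<Gamma>\<close>,
  which is the form in which the special copies of the second moment bound are available.\<close>

lemma embedding_imp_good_colouring:
  assumes \<Gamma>: "finite_graph \<Gamma>" and inj: "inj_on f (verts \<Gamma>)" and V: "f ` verts \<Gamma> \<subseteq> verts H"
    and E: "\<And>e. e \<in> edges \<Gamma> \<Longrightarrow> f ` e \<in> edges H"
    and good: "\<And>u v. {u, v} \<in> edges \<Gamma> \<Longrightarrow>
      w {f u, f v} \<le> \<bar>real (\<phi> (f u)) - real (\<phi> (f v))\<bar> \<and> \<bar>real (\<phi> (f u)) - real (\<phi> (f v))\<bar> \<le> M"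
  shows "good_colouring \<Gamma> M H w \<phi>"
proof -
  define T where "T = (f ` verts \<Gamma>, (`) f ` edges \<Gamma>)"
  have card_edge: "card (f ` e) = 2" if "e \<in> edges \<Gamma>" for e
    using finite_graph_edgeD[OF \<Gamma> that] inj card_image inj_on_subset by metis
  have fin: "finite_graph T"
    using \<Gamma> card_edge finite_graph_edgeD(1)[OF \<Gamma>]
    by (auto simp: finite_graph_def all_edges_def T_def)
  have iso: "graph_iso T \<Gamma>"
    unfolding graph_iso_def
  proof (intro exI conjI ballI)
    show "bij_betw (inv_into (verts \<Gamma>) f) (verts T) (verts \<Gamma>)"
      using inj by (simp add: T_def bij_betw_inv_into inj_on_imp_bij_betw)
    fix a b assume "a \<in> verts T" "b \<in> verts T"
    then obtain u v where uv: "u \<in> verts \<Gamma>" "v \<in> verts \<Gamma>" "a = f u" "b = f v"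
      by (auto simp: T_def)
    have "{f u, f v} \<in> (`) f ` edges \<Gamma> \<longleftrightarrow> {u, v} \<in> edges \<Gamma>"
    proof
      assume "{f u, f v} \<in> (`) f ` edges \<Gamma>"
      then obtain e where e: "e \<in> edges \<Gamma>" "f ` {u, v} = f ` e" by auto
      then have "{u, v} = e"
        using inj_on_image_eq_iff[OF inj] finite_graph_edgeD(1)[OF \<Gamma>] uv by (metis empty_subsetI insert_subset)
      then show "{u, v} \<in> edges \<Gamma>" using e by simp
    next
      assume "{u, v} \<in> edges \<Gamma>"
      then show "{f u, f v} \<in> (`) f ` edges \<Gamma>" by (intro image_eqI[where x = "{u, v}"]) auto
    qed
    then show "{a, b} \<in> edges T \<longleftrightarrow> {inv_into (verts \<Gamma>) f a, inv_into (verts \<Gamma>) f b} \<in> edges \<Gamma>"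
      using uv inj by (simp add: T_def)
  qed
  have "is_copy T \<Gamma> H"
    unfolding is_copy_def subgraph_def
    using fin V E iso card_image[OF inj] card_image[OF inj_on_image_edges[OF \<Gamma> inj]]
    by (auto simp: T_def)
  moreover have "good_subgraph M w \<phi> T"
    unfolding good_subgraph_def
  proof (intro allI impI)
    fix a b assume "{a, b} \<in> edges T"
    then obtain e where e: "e \<in> edges \<Gamma>" "f ` e = {a, b}" by (auto simp: T_def)
    obtain u v where uv: "e = {u, v}"
      using finite_graph_edgeD(2)[OF \<Gamma> e(1)] by (auto simp: card_2_iff)
    then have "a = f u \<and> b = f v \<or> a = f v \<and> b = f u"
      using e(2) by (auto simp: doubleton_eq_iff)
    moreover have "{v, u} \<in> edges \<Gamma>" "{u, v} \<in> edges \<Gamma>"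
      using e uv by (auto simp: insert_commute)
    ultimately show "w {a, b} \<le> \<bar>real (\<phi> a) - real (\<phi> b)\<bar> \<and> \<bar>real (\<phi> a) - real (\<phi> b)\<bar> \<le> M"
      using good[of u v] good[of v u] by auto
  qed
  ultimately show ?thesis
    unfolding good_colouring_def by blast
qed

text \<open>Converse direction, for the union bound over embeddings. Of goodness it keeps only the
  upper bound \<open>M\<close> on colour differences, which is what confines the colours of a
  copy.\<close>

lemma good_colouring_imp_embedding:
  assumes \<Gamma>: "finite_graph \<Gamma>" and good: "good_colouring \<Gamma> M H w \<phi>"
  obtains f where "f \<in> verts \<Gamma> \<rightarrow>\<^sub>E verts H" "inj_on f (verts \<Gamma>)"
    "\<forall>e\<in>edges \<Gamma>. f ` e \<in> edges H"
    "\<forall>u v. {u, v} \<in> edges \<Gamma> \<longrightarrow> \<bar>real (\<phi> (f u)) - real (\<phi> (f v))\<bar> \<le> M"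
proof -
  obtain T where T: "is_copy T \<Gamma> H" "good_subgraph M w \<phi> T"
    using good by (auto simp: good_colouring_def)
  then obtain g where g: "bij_betw g (verts T) (verts \<Gamma>)"
    "\<And>u v. u \<in> verts T \<Longrightarrow> v \<in> verts T \<Longrightarrow> {u, v} \<in> edges T \<longleftrightarrow> {g u, g v} \<in> edges \<Gamma>"
    by (auto simp: is_copy_def graph_iso_def)
  \<comment> \<open>The restriction makes \<open>f\<close> extensional, so that embeddings form a
    finite set of functions.\<close>
  define f where "f = restrict (inv_into (verts T) g) (verts \<Gamma>)"
  have bij: "bij_betw (inv_into (verts T) g) (verts \<Gamma>) (verts T)"
    using g(1) by (rule bij_betw_inv_into)
  have fT: "f v \<in> verts T" "g (f v) = v" if "v \<in> verts \<Gamma>" for v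
    using that g(1) bij by (auto simp: f_def bij_betw_def f_inv_into_f inv_into_into)
  have edge: "{f u, f v} \<in> edges T" if "{u, v} \<in> edges \<Gamma>" for u v
  proof -
    have "u \<in> verts \<Gamma>" "v \<in> verts \<Gamma>"
      using finite_graph_edgeD(1)[OF \<Gamma> that] by auto
    then show ?thesis
      using g(2)[of "f u" "f v"] fT that by simp
  qed
  show ?thesis
  proof (rule that[of f])
    show "f \<in> verts \<Gamma> \<rightarrow>\<^sub>E verts H"
      using fT T(1) by (auto simp: is_copy_def subgraph_def f_def)
    show "inj_on f (verts \<Gamma>)"
      using fT(2) by (metis inj_onI)
    show "\<forall>e\<in>edges \<Gamma>. f ` e \<in> edges H"
    proof
      fix e assume "e \<in> edges \<Gamma>"
      obtain u v where uv: "e = {u, v}"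
        using finite_graph_edgeD(2)[OF \<Gamma> \<open>e \<in> edges \<Gamma>\<close>] by (auto simp: card_2_iff)
      then show "f ` e \<in> edges H"
        using edge[of u v] \<open>e \<in> edges \<Gamma>\<close> T(1) by (auto simp: is_copy_def subgraph_def)
    qed
    show "\<forall>u v. {u, v} \<in> edges \<Gamma> \<longrightarrow> \<bar>real (\<phi> (f u)) - real (\<phi> (f v))\<bar> \<le> M"
      using edge T(2) by (auto simp: good_subgraph_def)
  qed
qed

section \<open>First moment: the expected number of good colourings\<close>

text \<open>Along a path each edge changes the colour by at most \<open>M\<close>, so the bound
  between two vertices depends on the path and on \<open>M\<close> but not on \<open>c\<close>. With
  finitely many pairs of vertices one \<open>D\<close> suffices.\<close>

lemma connected_graph_oscillation:
  fixes \<Gamma> :: "'b graph"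
  assumes conn: "connected_graph \<Gamma>" and fin: "finite (verts \<Gamma>)"
  obtains D :: nat where "\<And>c :: 'b \<Rightarrow> real. \<forall>u v. {u, v} \<in> edges \<Gamma> \<longrightarrow> \<bar>c u - c v\<bar> \<le> M \<Longrightarrow>
      \<forall>u\<in>verts \<Gamma>. \<forall>v\<in>verts \<Gamma>. \<bar>c u - c v\<bar> \<le> real D"
proof -
  define ok where "ok c \<longleftrightarrow> (\<forall>u v. {u, v} \<in> edges \<Gamma> \<longrightarrow> \<bar>c u - c v\<bar> \<le> M)" for c :: "'b \<Rightarrow> real"
  have "\<exists>d\<ge>0. \<forall>c. ok c \<longrightarrow> \<bar>c u - c v\<bar> \<le> d" if "u \<in> verts \<Gamma>" "v \<in> verts \<Gamma>" for u v
  proof -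
    have "(u, v) \<in> {(x, y). {x, y} \<in> edges \<Gamma>}\<^sup>*"
      using conn that by (auto simp: connected_graph_def)
    then show ?thesis
    proof (induction rule: rtrancl_induct)
      case base
      then show ?case by auto
    next
      case (step y z)
      then obtain d where d: "d \<ge> 0" "\<And>c. ok c \<Longrightarrow> \<bar>c u - c y\<bar> \<le> d" by auto
      have "\<bar>c u - c z\<bar> \<le> d + \<bar>M\<bar>" if "ok c" for c
      proof -
        have "\<bar>c y - c z\<bar> \<le> M"
          using step that by (auto simp: ok_def)
        then show ?thesis using d(2)[OF that] by linarith
      qed
      then show ?case using d(1) by (intro exI[of _ "d + \<bar>M\<bar>"]) auto
    qed
  qed
  then obtain d where d: "\<And>u v. u \<in> verts \<Gamma> \<Longrightarrow> v \<in> verts \<Gamma> \<Longrightarrow> 0 \<le> d u v"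
    "\<And>u v c. u \<in> verts \<Gamma> \<Longrightarrow> v \<in> verts \<Gamma> \<Longrightarrow> ok c \<Longrightarrow> \<bar>c u - c v\<bar> \<le> d u v"
    by metis
  \<comment> \<open>The summands are nonnegative, so the sum over all pairs dominates each
    \<open>d u v\<close>.\<close>
  define D where "D = nat \<lceil>\<Sum>u\<in>verts \<Gamma>. \<Sum>v\<in>verts \<Gamma>. d u v\<rceil>"
  have dD: "d u v \<le> real D" if uv: "u \<in> verts \<Gamma>" "v \<in> verts \<Gamma>" for u v
  proof -
    have "d u v \<le> (\<Sum>v\<in>verts \<Gamma>. d u v)"
      using fin d(1) uv by (intro member_le_sum) auto
    also have "\<dots> \<le> (\<Sum>u\<in>verts \<Gamma>. \<Sum>v\<in>verts \<Gamma>. d u v)"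
      using fin d(1) uv by (intro member_le_sum[where f = "\<lambda>u. \<Sum>v\<in>verts \<Gamma>. d u v"]) (auto intro: sum_nonneg)
    also have "\<dots> \<le> real D"
      unfolding D_def by linarith
    finally show ?thesis .
  qed
  show ?thesis
  proof (rule that[of D])
    fix c :: "'b \<Rightarrow> real"
    assume "\<forall>u v. {u, v} \<in> edges \<Gamma> \<longrightarrow> \<bar>c u - c v\<bar> \<le> M"
    then have "ok c" by (auto simp: ok_def)
    then show "\<forall>u\<in>verts \<Gamma>. \<forall>v\<in>verts \<Gamma>. \<bar>c u - c v\<bar> \<le> real D"
      using d(2) dD order_trans by blast
  qed
qed

text \<open>Choose the colour \<open>c\<close> of one vertex of \<open>S\<close> in \<open>r\<close>
  ways; every vertex of \<open>S\<close> then has its colour in a window around \<open>c\<close>,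
  and the vertices outside \<open>S\<close> are free.\<close>

lemma card_clustered_colourings:
  assumes V: "finite V" and S: "S \<subseteq> V" "S \<noteq> {}"
  shows "card {\<phi>\<in>colourings V r. \<forall>x\<in>S. \<forall>y\<in>S. \<bar>real (\<phi> x) - real (\<phi> y)\<bar> \<le> real D}
    \<le> r * ((2 * D + 1) ^ card S * r ^ (card V - card S))"
proof -
  \<comment> \<open>Subtraction on naturals cuts the window off at 0, and the window may exceed
    \<open>r\<close>; its size is at most \<open>2 * D + 1\<close> in every case.\<close>
  define P where "P c = (\<Pi>\<^sub>E x\<in>V. if x \<in> S then {c - D..c + D} else {1..r})" for c
  obtain x0 where x0: "x0 \<in> S" using S by auto
  have "{\<phi>\<in>colourings V r. \<forall>x\<in>S. \<forall>y\<in>S. \<bar>real (\<phi> x) - real (\<phi> y)\<bar> \<le> real D} \<subseteq> (\<Union>c\<in>{1..r}. P c)"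
  proof
    fix \<phi> assume "\<phi> \<in> {\<phi>\<in>colourings V r. \<forall>x\<in>S. \<forall>y\<in>S. \<bar>real (\<phi> x) - real (\<phi> y)\<bar> \<le> real D}"
    then have \<phi>: "\<phi> \<in> V \<rightarrow>\<^sub>E {1..r}" and close: "\<And>x. x \<in> S \<Longrightarrow> \<bar>real (\<phi> x) - real (\<phi> x0)\<bar> \<le> real D"
      using x0 by (auto simp: colourings_def)
    have "\<phi> x \<in> {\<phi> x0 - D..\<phi> x0 + D}" if "x \<in> S" for x
      using close[OF that] by (auto simp: abs_le_iff)
    then have "\<phi> \<in> P (\<phi> x0)"
      using \<phi> by (auto simp: P_def PiE_iff)
    moreover have "\<phi> x0 \<in> {1..r}"
      using \<phi> x0 S by (auto simp: PiE_iff)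
    ultimately show "\<phi> \<in> (\<Union>c\<in>{1..r}. P c)" by blast
  qed
  moreover have "finite (P c)" for c
    using V by (auto simp: P_def intro!: finite_PiE)
  ultimately have "card {\<phi>\<in>colourings V r. \<forall>x\<in>S. \<forall>y\<in>S. \<bar>real (\<phi> x) - real (\<phi> y)\<bar> \<le> real D} \<le> card (\<Union>c\<in>{1..r}. P c)"
    by (intro card_mono) auto
  also have "\<dots> \<le> (\<Sum>c\<in>{1..r}. card (P c))"
    by (intro card_UN_le) auto
  also have "\<dots> \<le> (\<Sum>c\<in>{1..r}. (2 * D + 1) ^ card S * r ^ (card V - card S))"
  proof (intro sum_mono)
    fix c
    have "card (P c) = (\<Prod>x\<in>S. card {c - D..c + D}) * r ^ (card V - card S)"
      unfolding P_def by (subst card_PiE_if[OF V S(1)]) simp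
    also have "\<dots> \<le> (2 * D + 1) ^ card S * r ^ (card V - card S)"
      by (intro mult_right_mono) (auto intro!: power_mono)
    finally show "card (P c) \<le> (2 * D + 1) ^ card S * r ^ (card V - card S)" .
  qed
  finally show ?thesis by simp
qed

text \<open>Union bound over the at most \<open>n ^ card (verts \<Gamma>)\<close> injective maps:
  the edges of the image are all open with probability \<open>p ^ card (edges \<Gamma>)\<close>, and
  the colourings clustered on the image are counted by
  \<open>card_clustered_colourings\<close>.\<close>

lemma expectation_N_good_le:
  fixes \<Gamma> :: "'b graph"
  assumes we: "weighted_edges \<Omega> n p W X w" and \<Gamma>: "finite_graph \<Gamma>" "verts \<Gamma> \<noteq> {}"
    and n: "2 \<le> n" and p: "0 \<le> p"
    and D: "\<And>c :: 'b \<Rightarrow> real. \<forall>u v. {u, v} \<in> edges \<Gamma> \<longrightarrow> \<bar>c u - c v\<bar> \<le> M \<Longrightarrow>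
      \<forall>u\<in>verts \<Gamma>. \<forall>v\<in>verts \<Gamma>. \<bar>c u - c v\<bar> \<le> real D"
  shows "(\<integral>\<omega>. real (N_good \<Gamma> M r (open_graph n (\<lambda>h. X h \<omega>)) (\<lambda>h. w h \<omega>)) \<partial>\<Omega>)
    \<le> real n ^ card (verts \<Gamma>) * (real r * ((2 * real D + 1) ^ card (verts \<Gamma>) * real r ^ (n - card (verts \<Gamma>))))
        * p ^ card (edges \<Gamma>)"
proof -
  interpret prob_space \<Omega>
    using we by (simp add: weighted_edges_def)
  interpret W: prob_space W
    using weighted_edges_law[OF we n] by simp
  have W1: "measure W UNIV = 1"
    using W.prob_space sets_eq_imp_space_eq[OF weighted_edges_law(2)[OF we n]] by simp
  define v0 where "v0 = card (verts \<Gamma>)"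
  have finV: "finite (verts \<Gamma>)"
    using \<Gamma> by (simp add: finite_graph_def)
  define I where "I = {f \<in> verts \<Gamma> \<rightarrow>\<^sub>E {..<n}. inj_on f (verts \<Gamma>)}"
  define S where "S f = {\<phi>\<in>colourings {..<n} r. \<forall>x\<in>f ` verts \<Gamma>. \<forall>y\<in>f ` verts \<Gamma>.
    \<bar>real (\<phi> x) - real (\<phi> y)\<bar> \<le> real D}" for f
  \<comment> \<open>The condition with \<open>UNIV\<close> puts the event into the form of
    \<open>weighted_edges_prob\<close>, with factor \<open>measure W UNIV = 1\<close>.\<close>
  define F where "F f = {\<omega> \<in> space \<Omega>. \<forall>h\<in>(`) f ` edges \<Gamma>. X h \<omega> = 1 \<and> w h \<omega> \<in> UNIV}" for f
  define c where "c = real r * ((2 * real D + 1) ^ v0 * real r ^ (n - v0))"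
  have finI: "finite I"
    using finV by (auto simp: I_def intro!: finite_PiE)
  have finS: "finite (S f)" for f
    by (auto simp: S_def colourings_def intro!: finite_PiE)
  have cardI: "card I \<le> n ^ v0"
    using card_mono[of "verts \<Gamma> \<rightarrow>\<^sub>E {..<n}" I] finV
    by (auto simp: I_def card_PiE v0_def finite_PiE)
  have edges: "(`) f ` edges \<Gamma> \<subseteq> K_edges n" if "f \<in> I" for f
  proof
    fix h assume "h \<in> (`) f ` edges \<Gamma>"
    then obtain e where e: "e \<in> edges \<Gamma>" "h = f ` e" by auto
    have "card h = 2"
      using finite_graph_edgeD[OF \<Gamma>(1) e(1)] that e(2) inj_on_subset
      by (metis (mono_tags, lifting) I_def card_image mem_Collect_eq)
    moreover have "h \<subseteq> {..<n}"
      using finite_graph_edgeD(1)[OF \<Gamma>(1) e(1)] that e(2) by (auto simp: I_def PiE_iff)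
    ultimately show "h \<in> K_edges n" by (simp add: all_edges_def)
  qed
  have F: "F f \<in> events" "prob (F f) = p ^ card (edges \<Gamma>)" if "f \<in> I" for f
  proof -
    show "F f \<in> events"
      unfolding F_def by (rule weighted_edges_prob(2)[OF we edges[OF that]]) auto
    have "card ((`) f ` edges \<Gamma>) = card (edges \<Gamma>)"
      using that by (intro card_image inj_on_image_edges \<Gamma>) (auto simp: I_def)
    then show "prob (F f) = p ^ card (edges \<Gamma>)"
      unfolding F_def by (subst weighted_edges_prob(1)[OF we edges[OF that]]) (auto simp: W1)
  qed
  have cardS: "real (card (S f)) \<le> c" if "f \<in> I" for f
  proof -
    have "card (S f) \<le> r * ((2 * D + 1) ^ card (f ` verts \<Gamma>) * r ^ (card {..<n} - card (f ` verts \<Gamma>)))"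
      unfolding S_def using that \<Gamma> by (intro card_clustered_colourings) (auto simp: I_def)
    also have "card (f ` verts \<Gamma>) = v0"
      using that by (auto simp: I_def v0_def card_image)
    finally have "real (card (S f)) \<le> real (r * ((2 * D + 1) ^ v0 * r ^ (card {..<n} - v0)))"
      by (rule of_nat_mono)
    then show ?thesis by (simp add: c_def add_ac)
  qed
  have int: "integrable \<Omega> (\<lambda>\<omega>. indicator (F f) \<omega> :: real)" if "f \<in> I" for f
    using F(1)[OF that] by (simp add: less_top[symmetric])
  have "real (N_good \<Gamma> M r (open_graph n (\<lambda>h. X h \<omega>)) (\<lambda>h. w h \<omega>)) \<le> (\<Sum>f\<in>I. c * indicator (F f) \<omega>)"
    if \<omega>: "\<omega> \<in> space \<Omega>" for \<omega>
  proof -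
    let ?good = "{\<phi> \<in> colourings {..<n} r. good_colouring \<Gamma> M (open_graph n (\<lambda>h. X h \<omega>)) (\<lambda>h. w h \<omega>) \<phi>}"
    \<comment> \<open>Every good colouring is clustered on the image of some embedding whose edges
      are all open.\<close>
    have "?good \<subseteq> (\<Union>f\<in>{f\<in>I. \<omega> \<in> F f}. S f)"
    proof
      fix \<phi> assume \<phi>: "\<phi> \<in> ?good"
      then have g: "good_colouring \<Gamma> M (open_graph n (\<lambda>h. X h \<omega>)) (\<lambda>h. w h \<omega>) \<phi>" by simp
      obtain f where f: "f \<in> verts \<Gamma> \<rightarrow>\<^sub>E verts (open_graph n (\<lambda>h. X h \<omega>))" "inj_on f (verts \<Gamma>)"
        "\<forall>e\<in>edges \<Gamma>. f ` e \<in> edges (open_graph n (\<lambda>h. X h \<omega>))"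
        "\<forall>u v. {u, v} \<in> edges \<Gamma> \<longrightarrow> \<bar>real (\<phi> (f u)) - real (\<phi> (f v))\<bar> \<le> M"
        by (rule good_colouring_imp_embedding[OF \<Gamma>(1) g])
      have "f \<in> I" "\<omega> \<in> F f"
        using f \<omega> by (auto simp: I_def F_def open_graph_def)
      moreover have "\<phi> \<in> S f"
        using \<phi> D[of "\<lambda>v. real (\<phi> (f v))", OF f(4)] by (auto simp: S_def)
      ultimately show "\<phi> \<in> (\<Union>f\<in>{f\<in>I. \<omega> \<in> F f}. S f)" by blast
    qed
    then have "card ?good \<le> card (\<Union>f\<in>{f\<in>I. \<omega> \<in> F f}. S f)"
      using finI finS by (intro card_mono) auto
    also have "\<dots> \<le> (\<Sum>f\<in>{f\<in>I. \<omega> \<in> F f}. card (S f))"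
      using finI by (intro card_UN_le) auto
    finally have "real (card ?good) \<le> real (\<Sum>f\<in>{f\<in>I. \<omega> \<in> F f}. card (S f))"
      by (rule of_nat_mono)
    also have "\<dots> = (\<Sum>f\<in>{f\<in>I. \<omega> \<in> F f}. real (card (S f)))"
      by simp
    also have "\<dots> \<le> (\<Sum>f\<in>{f\<in>I. \<omega> \<in> F f}. c)"
      using cardS by (intro sum_mono) auto
    also have "\<dots> = (\<Sum>f\<in>I. c * indicator (F f) \<omega>)"
      using finI by (simp add: indicator_def if_distrib sum.If_cases Int_def cong: if_cong)
    finally show ?thesis by (simp add: N_good_def open_graph_def)
  qed
  then have "(\<integral>\<omega>. real (N_good \<Gamma> M r (open_graph n (\<lambda>h. X h \<omega>)) (\<lambda>h. w h \<omega>)) \<partial>\<Omega>)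
      \<le> (\<integral>\<omega>. (\<Sum>f\<in>I. c * indicator (F f) \<omega>) \<partial>\<Omega>)"
    using int N_good_integrable[OF we, of \<Gamma> M r] by (intro integral_mono) auto
  also have "\<dots> = (\<Sum>f\<in>I. c * prob (F f))"
    using int F(1) by (simp add: Bochner_Integration.integral_sum)
  also have "\<dots> = real (card I) * (c * p ^ card (edges \<Gamma>))"
    using F(2) by simp
  also have "\<dots> \<le> real n ^ v0 * (c * p ^ card (edges \<Gamma>))"
    using of_nat_mono[OF cardI, where 'a = real] p by (intro mult_right_mono) (auto simp: c_def)
  finally show ?thesis by (simp add: c_def v0_def mult_ac)
qed

section \<open>Second moment: the expected number of colourings that are not good\<close>

lemma card_colourings:
  "finite V \<Longrightarrow> card (colourings V r) = r ^ card V"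
  by (simp add: colourings_def card_PiE)

text \<open>The restriction of a uniform colouring to \<open>S\<close> is uniform. This gives the
  colour probability of one special copy, and of two when applied to the union of their vertex
  sets.\<close>

lemma card_colourings_prescribed:
  assumes V: "finite V" "S \<subseteq> V" and \<psi>: "\<And>x. x \<in> S \<Longrightarrow> \<psi> x \<in> {1..r}" and r: "0 < r"
  shows "real (card {\<phi>\<in>colourings V r. \<forall>x\<in>S. \<phi> x = \<psi> x}) / card (colourings V r) = (1 / real r) ^ card S"
proof -
  have "{\<phi>\<in>colourings V r. \<forall>x\<in>S. \<phi> x = \<psi> x} = (\<Pi>\<^sub>E x\<in>V. if x \<in> S then {\<psi> x} else {1..r})"
    (is "?P = ?Q")
  proof
    show "?P \<subseteq> ?Q"
      by (auto simp: colourings_def PiE_iff extensional_def)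
    show "?Q \<subseteq> ?P"
    proof
      fix \<phi> assume \<phi>: "\<phi> \<in> ?Q"
      have eq: "\<phi> x = \<psi> x" if "x \<in> S" for x
        using PiE_mem[OF \<phi>, of x] V(2) that by auto
      have "\<phi> x \<in> {1..r}" if "x \<in> V" for x
        using PiE_mem[OF \<phi> that] eq[of x] \<psi>[of x] by (cases "x \<in> S") auto
      with \<phi> eq show "\<phi> \<in> ?P"
        by (simp add: colourings_def PiE_iff)
    qed
  qed
  then have card: "card {\<phi>\<in>colourings V r. \<forall>x\<in>S. \<phi> x = \<psi> x} = r ^ (card V - card S)"
    using card_PiE_if[OF V, of "\<lambda>x. {\<psi> x}" "{1..r}"] by simp
  have "card V = (card V - card S) + card S"
    using V card_mono by fastforce
  then have "real r ^ card V = real r ^ (card V - card S) * real r ^ card S"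
    by (metis power_add)
  then show ?thesis
    using r V by (simp add: card card_colourings power_divide divide_simps)
qed

text \<open>The summand is a product over \<open>V\<close>, so the sum is a product of sums. Each
  factor has one term \<open>m\<close> and \<open>m - 1\<close> terms 1, hence is at most
  \<open>2 * m\<close>. This replaces a sum over all possible overlaps of two copies.\<close>

lemma sum_power_agreements:
  assumes V: "finite V" and a: "a \<in> V \<rightarrow>\<^sub>E {..<m}"
  shows "(\<Sum>a'\<in>V \<rightarrow>\<^sub>E {..<m}. real m ^ card {v\<in>V. a v = a' v}) \<le> (2 * real m) ^ card V"
proof -
  have "real m ^ card {v\<in>V. a v = a' v} = (\<Prod>v\<in>V. if a v = a' v then real m else 1)" for a'
    using V by (simp add: prod.If_cases Int_def)
  then have "(\<Sum>a'\<in>V \<rightarrow>\<^sub>E {..<m}. real m ^ card {v\<in>V. a v = a' v}) =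
      (\<Prod>v\<in>V. \<Sum>y<m. if a v = y then real m else 1)"
    using V by (simp add: prod_sum_PiE)
  also have "\<dots> \<le> (\<Prod>v\<in>V. 2 * real m)"
  proof (intro prod_mono conjI)
    fix v assume "v \<in> V"
    have "(\<Sum>y<m. if a v = y then real m else 1) \<le> (\<Sum>y<m. (if a v = y then real m else 0) + 1)"
      by (intro sum_mono) auto
    also have "\<dots> \<le> 2 * real m"
      by (simp add: sum.distrib)
    finally show "(\<Sum>y<m. if a v = y then real m else 1) \<le> 2 * real m" .
  qed (auto intro!: sum_nonneg)
  finally show ?thesis by simp
qed

text \<open>\<open>d\<close> reads off the block of a host vertex. A common vertex therefore plays
  the same role in both copies, so the overlap is described by the set where \<open>f\<close> and
  \<open>g\<close> agree, and common edges come from edges of \<open>\<Gamma>\<close> inside that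
  set.\<close>

lemma partite_embeddings_inter:
  fixes enc :: "'b \<Rightarrow> nat"
  assumes \<Gamma>: "finite_graph \<Gamma>" and enc: "inj_on enc (verts \<Gamma>)"
    and f: "\<And>v. v \<in> verts \<Gamma> \<Longrightarrow> d (f v) = enc v" and g: "\<And>v. v \<in> verts \<Gamma> \<Longrightarrow> d (g v) = enc v"
  shows "f ` verts \<Gamma> \<inter> g ` verts \<Gamma> = f ` {v\<in>verts \<Gamma>. f v = g v}"
    and "(`) f ` edges \<Gamma> \<inter> (`) g ` edges \<Gamma> \<subseteq> (`) f ` {e\<in>edges \<Gamma>. e \<subseteq> {v\<in>verts \<Gamma>. f v = g v}}"
proof -
  have eq: "u = v" if "u \<in> verts \<Gamma>" "v \<in> verts \<Gamma>" "f u = g v" for u v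
    using f[OF that(1)] g[OF that(2)] that enc by (auto simp: inj_on_def)
  show "f ` verts \<Gamma> \<inter> g ` verts \<Gamma> = f ` {v\<in>verts \<Gamma>. f v = g v}"
  proof (intro equalityI subsetI)
    fix x assume "x \<in> f ` verts \<Gamma> \<inter> g ` verts \<Gamma>"
    then obtain u v where uv: "u \<in> verts \<Gamma>" "v \<in> verts \<Gamma>" "x = f u" "f u = g v" by auto
    then show "x \<in> f ` {v\<in>verts \<Gamma>. f v = g v}" using eq[of u v] by auto
  next
    fix x assume "x \<in> f ` {v\<in>verts \<Gamma>. f v = g v}"
    then obtain v where "v \<in> verts \<Gamma>" "x = f v" "x = g v" by auto
    then show "x \<in> f ` verts \<Gamma> \<inter> g ` verts \<Gamma>" by blast
  qed
  show "(`) f ` edges \<Gamma> \<inter> (`) g ` edges \<Gamma> \<subseteq> (`) f ` {e\<in>edges \<Gamma>. e \<subseteq> {v\<in>verts \<Gamma>. f v = g v}}"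
  proof
    fix h assume "h \<in> (`) f ` edges \<Gamma> \<inter> (`) g ` edges \<Gamma>"
    then obtain e e' where e: "e \<in> edges \<Gamma>" "h = f ` e" "e' \<in> edges \<Gamma>" "h = g ` e'" by auto
    have "f v = g v" if "v \<in> e" for v
    proof -
      have "f v \<in> g ` e'" using e that by auto
      then obtain v' where "v' \<in> e'" "f v = g v'" by auto
      moreover have "v \<in> verts \<Gamma>" "v' \<in> verts \<Gamma>"
        using finite_graph_edgeD(1)[OF \<Gamma>] e that calculation by blast+
      ultimately show ?thesis using eq by metis
    qed
    then have "e \<in> {e\<in>edges \<Gamma>. e \<subseteq> {v\<in>verts \<Gamma>. f v = g v}}"
      using e(1) finite_graph_edgeD(1)[OF \<Gamma> e(1)] by auto
    then show "h \<in> (`) f ` {e\<in>edges \<Gamma>. e \<subseteq> {v\<in>verts \<Gamma>. f v = g v}}"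
      unfolding e(2) by (rule imageI)
  qed
qed

text \<open>Here \<open>b\<close> controls the variance of the number of special copies relative to
  the squared mean. Two copies with equal base colour that overlap in \<open>I\<close> are more
  likely than independent ones by a factor of at most \<open>r ^ card I\<close> divided by
  \<open>\<rho>\<close> to the number of edges inside \<open>I\<close>; \<open>bound\<close> caps
  this by \<open>real K * b * real m ^ card I\<close>, a form that
  \<open>sum_power_agreements\<close> can sum over the second copy.\<close>

lemma expectation_N_bad_le:
  fixes \<Gamma> :: "'b graph" and L K m :: nat
  assumes we: "weighted_edges \<Omega> n p W X w" and \<Gamma>: "finite_graph \<Gamma>"
    and m: "0 < m" "card (verts \<Gamma>) * m \<le> n"
    and K: "0 < K" "K + L * card (verts \<Gamma>) \<le> r"
    and M: "real (L * card (verts \<Gamma>)) \<le> M"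
    and \<rho>: "\<rho> = p * measure W {..real L}" "0 < \<rho>" "\<rho> \<le> 1"
    and b: "0 \<le> b"
    and bound: "\<And>I. I \<subseteq> verts \<Gamma> \<Longrightarrow> I \<noteq> {} \<Longrightarrow>
      real r ^ card I \<le> \<rho> ^ card {e\<in>edges \<Gamma>. e \<subseteq> I} * real m ^ card I * (real K * b)"
  shows "(\<integral>\<omega>. real (r ^ n) - real (N_good \<Gamma> M r (open_graph n (\<lambda>h. X h \<omega>)) (\<lambda>h. w h \<omega>)) \<partial>\<Omega>)
    \<le> real (r ^ n) * (2 ^ card (verts \<Gamma>) * b)"
proof -
  interpret prob_space \<Omega>
    using we by (simp add: weighted_edges_def)
  define V where "V = verts \<Gamma>"
  define E where "E = edges \<Gamma>"
  define v0 where "v0 = card V"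
  define e0 where "e0 = card E"
  have finV: "finite V" and finE: "finite E"
    using \<Gamma> finite_all_edges[of V] by (auto simp: finite_graph_def V_def E_def intro: finite_subset)
  have r: "0 < r" using K by simp
  obtain enc where enc: "bij_betw enc V {..<v0}"
    using finV ex_bij_betw_finite_nat[of V] by (auto simp: v0_def atLeast0LessThan)
  then have enc_inj: "inj_on enc V" and enc_less: "\<And>v. v \<in> V \<Longrightarrow> enc v < v0"
    by (auto simp: bij_betw_def)
  \<comment> \<open>The block of a vertex \<open>x\<close> is \<open>x div m\<close>, so the prescribed colour \<open>\<psi> c x\<close> below depends on \<open>x\<close> alone.\<close>
  define emb where "emb a v = enc v * m + a v" for a :: "'b \<Rightarrow> nat" and v
  define A where "A = V \<rightarrow>\<^sub>E {..<m}"
  \<comment> \<open>An index consists of a position in each block and a base colour; at most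
    \<open>K\<close> base colours are used, so that all prescribed colours stay within
    \<open>r\<close>.\<close>
  define J where "J = A \<times> {1..K}"
  define S where "S a = emb a ` V" for a
  define T where "T a = (`) (emb a) ` E" for a
  define \<psi> where "\<psi> c x = c + L * (x div m)" for c x
  define B where "B j = {\<phi>. \<forall>x\<in>S (fst j). \<phi> x = \<psi> (snd j) x}" for j
  define F where "F j = {\<omega> \<in> space \<Omega>. \<forall>h\<in>T (fst j). X h \<omega> = 1 \<and> w h \<omega> \<in> {..real L}}" for j :: "('b \<Rightarrow> nat) \<times> nat"
  define \<Phi> where "\<Phi> = colourings {..<n} r"
  \<comment> \<open>The probability that a given special copy is present and coloured as prescribed;
    hence \<open>\<mu>\<close> is \<open>\<pi>\<close> times the number of indices.\<close>
  define \<pi> where "\<pi> = (1 / real r) ^ v0 * \<rho> ^ e0"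
  define \<mu> where "\<mu> = (\<Sum>j\<in>J. real (card (\<Phi> \<inter> B j)) / card \<Phi> * prob (F j))"
  have \<pi>: "0 < \<pi>" using r \<rho> by (simp add: \<pi>_def)
  have fin: "finite \<Phi>" "\<Phi> \<noteq> {}" "finite J"
    using finV r by (auto simp: \<Phi>_def colourings_def J_def A_def PiE_eq_empty_iff intro!: finite_PiE)
  have card\<Phi>: "card \<Phi> = r ^ n"
    by (simp add: \<Phi>_def card_colourings)
  have cardA: "real (card A) = real m ^ v0"
    using finV by (simp add: A_def card_PiE v0_def)
  have div: "emb a v div m = enc v" if "a \<in> A" "v \<in> V" for a v
  proof -
    have "a v < m" using that by (auto simp: A_def PiE_iff)
    then show ?thesis by (simp add: emb_def)
  qed
  have emb_inj: "inj_on (emb a) V" if "a \<in> A" for a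
    using div[OF that] enc_inj by (metis inj_on_def)
  have S_sub: "S a \<subseteq> {..<n}" if "a \<in> A" for a
  proof -
    have "emb a v < n" if "v \<in> V" for v
    proof -
      have "a v < m" using that \<open>a \<in> A\<close> by (auto simp: A_def PiE_iff)
      then have "emb a v < Suc (enc v) * m" by (simp add: emb_def)
      also have "\<dots> \<le> v0 * m" using enc_less[OF that] by (intro mult_right_mono) auto
      also have "\<dots> \<le> n" using m by (simp add: v0_def V_def)
      finally show ?thesis .
    qed
    then show ?thesis by (auto simp: S_def)
  qed
  have T_sub: "T a \<subseteq> K_edges n" if "a \<in> A" for a
  proof
    fix h assume "h \<in> T a"
    then obtain e where e: "e \<in> edges \<Gamma>" "h = emb a ` e" by (auto simp: T_def E_def)
    have "card h = 2"
      using finite_graph_edgeD[OF \<Gamma> e(1)] e(2) inj_on_subset emb_inj[OF that]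
      by (metis V_def card_image)
    moreover have "h \<subseteq> {..<n}"
      using finite_graph_edgeD(1)[OF \<Gamma> e(1)] S_sub[OF that] e(2) by (auto simp: S_def V_def)
    ultimately show "h \<in> K_edges n" by (simp add: all_edges_def)
  qed
  have cardS: "card (S a) = v0" and cardT: "card (T a) = e0" if "a \<in> A" for a
    using emb_inj[OF that] inj_on_image_edges[OF \<Gamma>, of "emb a"]
    by (auto simp: S_def v0_def card_image T_def E_def e0_def V_def)
  have finS: "finite (S a)" and finT: "finite (T a)" for a
    using finV finE by (auto simp: S_def T_def)
  have \<psi>_range: "\<psi> c x \<in> {1..r}" if "a \<in> A" "c \<in> {1..K}" "x \<in> S a" for a c x
  proof -
    obtain v where v: "v \<in> V" "x = emb a v" using \<open>x \<in> S a\<close> by (auto simp: S_def)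
    have "L * enc v \<le> L * v0" using enc_less[OF v(1)] by (intro mult_left_mono) auto
    then have "c + L * enc v \<le> r"
      using K \<open>c \<in> {1..K}\<close> unfolding v0_def V_def atLeastAtMost_iff by linarith
    then show ?thesis
      using that div[OF that(1) v(1)] by (simp add: \<psi>_def v)
  qed
  have probF: "F j \<in> events" "prob (F j) = \<rho> ^ e0" if "j \<in> J" for j
    using weighted_edges_prob[OF we T_sub[of "fst j"], of "{..real L}"] cardT[of "fst j"] that
    by (auto simp: F_def J_def \<rho>(1))
  have cardB: "real (card (\<Phi> \<inter> B j)) / card \<Phi> = (1 / real r) ^ v0" if "j \<in> J" for j
  proof -
    have "\<Phi> \<inter> B j = {\<phi>\<in>colourings {..<n} r. \<forall>x\<in>S (fst j). \<phi> x = \<psi> (snd j) x}"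
      by (auto simp: \<Phi>_def B_def)
    then show ?thesis
      using card_colourings_prescribed[of "{..<n}" "S (fst j)" "\<psi> (snd j)" r] that S_sub \<psi>_range cardS r
      by (auto simp: J_def \<Phi>_def)
  qed
  have \<mu>_eq: "\<mu> = real m ^ v0 * real K * \<pi>"
    using cardB probF by (simp add: \<mu>_def \<pi>_def J_def card_cartesian_product cardA)
  define agree where "agree a a' = {v\<in>V. a v = a' v}" for a a' :: "'b \<Rightarrow> nat"
  \<comment> \<open>Disjoint copies are independent and give \<open>\<pi>\<^sup>2\<close>.
    Overlapping copies with different base colours demand two colours at a common vertex and give 0.
    Only overlapping copies with the same base colour produce an excess.\<close>
  have pair: "real (card (\<Phi> \<inter> (B j \<inter> B k))) / card \<Phi> * prob (F j \<inter> F k)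
      \<le> \<pi>\<^sup>2 + (if snd j = snd k then \<pi>\<^sup>2 * (real K * b) * real m ^ card (agree (fst j) (fst k)) else 0)"
    if j: "j \<in> J" and k: "k \<in> J" for j k
  proof -
    obtain a c a' c' where jk: "j = (a, c)" "k = (a', c')" by (metis prod.exhaust)
    have mem: "a \<in> A" "a' \<in> A" "c \<in> {1..K}" "c' \<in> {1..K}"
      using j k by (auto simp: jk J_def)
    define I where "I = agree a a'"
    have I': "I = {v\<in>verts \<Gamma>. emb a v = emb a' v}"
      by (auto simp: I_def agree_def emb_def V_def)
    note inter = partite_embeddings_inter[OF \<Gamma>, of enc "\<lambda>x. x div m" "emb a" "emb a'", folded V_def E_def,
        OF enc_inj div[OF mem(1)] div[OF mem(2)], folded S_def T_def, unfolded V_def, folded I']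
    have cardSS: "card (S a \<union> S a') + card I = 2 * v0"
    proof -
      have "card (S a \<inter> S a') = card I"
        unfolding S_def V_def using inter(1) emb_inj[OF mem(1)]
        by (simp add: S_def V_def) (metis (no_types, lifting) I' card_image inj_on_subset mem_Collect_eq subsetI)
      then show ?thesis
        using card_Un_Int[OF finS[of a] finS[of a']] cardS mem by simp
    qed
    define d where "d = card (T a \<inter> T a')"
    have cardTT: "card (T a \<union> T a') + d = 2 * e0"
      using card_Un_Int[OF finT[of a] finT[of a']] cardT mem by (simp add: d_def)
    have d_le: "d \<le> card {e\<in>E. e \<subseteq> I}"
    proof -
      have "d \<le> card ((`) (emb a) ` {e\<in>E. e \<subseteq> I})"
        unfolding d_def using finE inter(2) by (intro card_mono) auto
      also have "\<dots> \<le> card {e\<in>E. e \<subseteq> I}"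
        using finE by (intro card_image_le) auto
      finally show ?thesis .
    qed
    have FF: "prob (F j \<inter> F k) = \<rho> ^ card (T a \<union> T a')"
    proof -
      have "F j \<inter> F k = {\<omega> \<in> space \<Omega>. \<forall>h\<in>T a \<union> T a'. X h \<omega> = 1 \<and> w h \<omega> \<in> {..real L}}"
        by (auto simp: F_def jk)
      then show ?thesis
        using weighted_edges_prob(1)[OF we, of "T a \<union> T a'" "{..real L}"] T_sub mem by (simp add: \<rho>(1))
    qed
    have BB: "real (card (\<Phi> \<inter> (B j \<inter> B k))) / card \<Phi> = (1 / real r) ^ card (S a \<union> S a')"
      if "\<And>x. x \<in> S a \<Longrightarrow> x \<in> S a' \<Longrightarrow> \<psi> c x = \<psi> c' x"
    proof -
      define \<xi> where "\<xi> x = (if x \<in> S a then \<psi> c x else \<psi> c' x)" for x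
      have "\<Phi> \<inter> (B j \<inter> B k) = {\<phi>\<in>colourings {..<n} r. \<forall>x\<in>S a \<union> S a'. \<phi> x = \<xi> x}"
        using that by (auto simp: \<Phi>_def B_def jk \<xi>_def)
      moreover have "\<xi> x \<in> {1..r}" if "x \<in> S a \<union> S a'" for x
        using that \<psi>_range mem unfolding \<xi>_def by (cases "x \<in> S a") auto
      ultimately show ?thesis
        using card_colourings_prescribed[of "{..<n}" "S a \<union> S a'" \<xi> r] S_sub mem r
        by (simp add: \<Phi>_def)
    qed
    have nonneg: "0 \<le> \<pi>\<^sup>2 * (real K * b) * real m ^ card I"
      using b by simp
    consider "I = {}" | "I \<noteq> {}" "c \<noteq> c'" | "I \<noteq> {}" "c = c'" by blast
    then show ?thesis
    proof cases
      case 1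
      have "{e\<in>E. e \<subseteq> I} = {}"
        using finite_graph_edgeD(2)[OF \<Gamma>, of "{}"] 1 by (auto simp: E_def)
      then have "d \<le> 0"
        using d_le by (simp only: card.empty)
      then have "card (T a \<union> T a') = 2 * e0"
        using cardTT by simp
      then have FF': "prob (F j \<inter> F k) = (\<rho> ^ e0)\<^sup>2"
        using FF by (simp add: power_mult[symmetric] mult.commute)
      have disj: "S a \<inter> S a' = {}" using inter(1) 1 by (simp add: S_def V_def)
      have "real (card (\<Phi> \<inter> (B j \<inter> B k))) / card \<Phi> = (1 / real r) ^ card (S a \<union> S a')"
        using disj by (intro BB) blast
      moreover have "card (S a \<union> S a') = v0 * 2"
        using cardSS 1 by simp
      ultimately have BB': "real (card (\<Phi> \<inter> (B j \<inter> B k))) / card \<Phi> = ((1 / real r) ^ v0)\<^sup>2"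
        by (simp only: power_mult)
      have "real (card (\<Phi> \<inter> (B j \<inter> B k))) / card \<Phi> * prob (F j \<inter> F k) = \<pi>\<^sup>2"
        unfolding FF' BB' by (simp add: \<pi>_def power_mult_distrib)
      then show ?thesis
        using nonneg by (simp add: jk I_def)
    next
      case 2
      then obtain v where v: "v \<in> V" "emb a v = emb a' v" by (auto simp: I' V_def)
      have "B j \<inter> B k = {}"
      proof (rule ccontr)
        assume "B j \<inter> B k \<noteq> {}"
        then obtain \<phi> where "\<phi> \<in> B j" "\<phi> \<in> B k" by auto
        then have "\<phi> (emb a v) = \<psi> c (emb a v)" "\<phi> (emb a' v) = \<psi> c' (emb a' v)"
          using v(1) by (auto simp: B_def jk S_def)
        then show False using v(2) 2 by (simp add: \<psi>_def)
      qed
      then show ?thesis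
        using 2 by (simp add: jk)
    next
      case 3
      define y where "y = 1 / real r"
      have y: "0 < y" "y * real r = 1" using r by (auto simp: y_def)
      \<comment> \<open>\<open>bound\<close> involves all edges inside \<open>I\<close>, while
        \<open>d\<close> counts the edges actually shared; as \<open>d\<close> is no larger and
        \<open>\<rho> \<le> 1\<close>, passing to \<open>d\<close> only increases the right
        side.\<close>
      have "real r ^ card I \<le> \<rho> ^ card {e\<in>E. e \<subseteq> I} * (real m ^ card I * (real K * b))"
        using bound[of I] 3 by (simp add: I' E_def mult_ac)
      also have "\<dots> \<le> \<rho> ^ d * (real m ^ card I * (real K * b))"
        using d_le \<rho> b by (intro mult_right_mono power_decreasing) auto
      finally have r_le: "real r ^ card I \<le> \<rho> ^ d * (real m ^ card I * (real K * b))" .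
      \<comment> \<open>Multiplying by \<open>y ^ card I * real r ^ card I = 1\<close> and using the
        bound on \<open>real r ^ card I\<close> completes the exponents of the unions to
        \<open>2 * v0\<close> and \<open>2 * e0\<close>, which is
        \<open>\<pi>\<^sup>2\<close>.\<close>
      have "y ^ card (S a \<union> S a') * \<rho> ^ card (T a \<union> T a')
          = y ^ card (S a \<union> S a') * \<rho> ^ card (T a \<union> T a') * y ^ card I * real r ^ card I"
        using y by (simp add: mult.assoc power_mult_distrib[symmetric])
      also have "\<dots> \<le> y ^ card (S a \<union> S a') * \<rho> ^ card (T a \<union> T a') * y ^ card I *
          (\<rho> ^ d * (real m ^ card I * (real K * b)))"
        using r_le y \<rho> by (intro mult_left_mono) auto
      also have "\<dots> = y ^ (card (S a \<union> S a') + card I) * \<rho> ^ (card (T a \<union> T a') + d) *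
          ((real K * b) * real m ^ card I)"
        by (simp add: power_add mult_ac)
      also have "\<dots> = \<pi>\<^sup>2 * ((real K * b) * real m ^ card I)"
        unfolding cardSS cardTT
        by (simp add: \<pi>_def y_def power_mult_distrib power_mult[symmetric] mult.commute)
      finally have "y ^ card (S a \<union> S a') * \<rho> ^ card (T a \<union> T a') \<le> \<pi>\<^sup>2 * ((real K * b) * real m ^ card I)" .
      moreover have "real (card (\<Phi> \<inter> (B j \<inter> B k))) / card \<Phi> * prob (F j \<inter> F k)
          = y ^ card (S a \<union> S a') * \<rho> ^ card (T a \<union> T a')"
        using FF BB 3 by (simp add: y_def)
      ultimately show ?thesis
        using 3 by (simp add: jk I_def mult.assoc add_increasing)
    qed
  qed
  have sum_J: "(\<Sum>j\<in>J. g j) = (\<Sum>a\<in>A. \<Sum>c\<in>{1..K}. g (a, c))" for g :: "_ \<Rightarrow> real"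
    by (simp add: J_def sum.cartesian_product')
  \<comment> \<open>The second index has only one admissible base colour, so one factor
    \<open>K\<close> is missing compared with the squared mean; the factor \<open>real K * b\<close>
    restores it.\<close>
  have "(\<Sum>j\<in>J. \<Sum>k\<in>J. if snd j = snd k then \<pi>\<^sup>2 * (real K * b) * real m ^ card (agree (fst j) (fst k)) else 0)
      = (\<Sum>a\<in>A. \<Sum>c\<in>{1..K}. \<Sum>a'\<in>A. \<pi>\<^sup>2 * (real K * b) * real m ^ card (agree a a'))"
    unfolding sum_J fst_conv snd_conv by (intro sum.cong refl) simp
  also have "\<dots> = (\<Sum>a\<in>A. real K * (\<pi>\<^sup>2 * (real K * b) * (\<Sum>a'\<in>A. real m ^ card (agree a a'))))"
    by (simp add: sum_distrib_left)
  also have "\<dots> \<le> (\<Sum>a\<in>A. real K * (\<pi>\<^sup>2 * (real K * b) * (2 * real m) ^ v0))"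
    using sum_power_agreements[OF finV] b
    by (intro sum_mono mult_left_mono) (auto simp: A_def agree_def v0_def)
  also have "\<dots> = \<mu>\<^sup>2 * (2 ^ v0 * b)"
    by (simp add: cardA \<mu>_eq power2_eq_square power_mult_distrib mult_ac)
  finally have coincident: "(\<Sum>j\<in>J. \<Sum>k\<in>J. if snd j = snd k
      then \<pi>\<^sup>2 * (real K * b) * real m ^ card (agree (fst j) (fst k)) else 0) \<le> \<mu>\<^sup>2 * (2 ^ v0 * b)" .
  have "(\<Sum>j\<in>J. \<Sum>k\<in>J. real (card (\<Phi> \<inter> (B j \<inter> B k))) / card \<Phi> * prob (F j \<inter> F k))
      \<le> (\<Sum>j\<in>J. \<Sum>k\<in>J. \<pi>\<^sup>2 + (if snd j = snd k then \<pi>\<^sup>2 * (real K * b) * real m ^ card (agree (fst j) (fst k)) else 0))"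
    using pair by (intro sum_mono)
  also have "\<dots> = \<mu>\<^sup>2 + (\<Sum>j\<in>J. \<Sum>k\<in>J. if snd j = snd k then \<pi>\<^sup>2 * (real K * b) * real m ^ card (agree (fst j) (fst k)) else 0)"
    by (simp add: sum.distrib \<mu>_eq J_def card_cartesian_product cardA power2_eq_square mult_ac)
  finally have excess: "(\<Sum>j\<in>J. \<Sum>k\<in>J. real (card (\<Phi> \<inter> (B j \<inter> B k))) / card \<Phi> * prob (F j \<inter> F k)) - \<mu>\<^sup>2
      \<le> \<mu>\<^sup>2 * (2 ^ v0 * b)"
    using coincident by linarith
  have "\<mu>\<^sup>2 * expectation (\<lambda>\<omega>. real (card {\<phi>\<in>\<Phi>. \<forall>j\<in>J. \<phi> \<in> B j \<longrightarrow> \<omega> \<notin> F j}))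
      \<le> card \<Phi> * ((\<Sum>j\<in>J. \<Sum>k\<in>J. real (card (\<Phi> \<inter> (B j \<inter> B k))) / card \<Phi> * prob (F j \<inter> F k)) - \<mu>\<^sup>2)"
    by (rule second_moment_count[OF fin probF(1) \<mu>_def])
  also have "\<dots> \<le> card \<Phi> * (\<mu>\<^sup>2 * (2 ^ v0 * b))"
    using excess by (intro mult_left_mono) auto
  finally have "\<mu>\<^sup>2 * expectation (\<lambda>\<omega>. real (card {\<phi>\<in>\<Phi>. \<forall>j\<in>J. \<phi> \<in> B j \<longrightarrow> \<omega> \<notin> F j})) \<le> \<mu>\<^sup>2 * (card \<Phi> * (2 ^ v0 * b))"
    by (simp only: mult_ac)
  moreover have "0 < \<mu>\<^sup>2"
    using \<pi> m K by (simp add: \<mu>_eq)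
  ultimately have bad: "expectation (\<lambda>\<omega>. real (card {\<phi>\<in>\<Phi>. \<forall>j\<in>J. \<phi> \<in> B j \<longrightarrow> \<omega> \<notin> F j})) \<le> card \<Phi> * (2 ^ v0 * b)"
    by (rule mult_left_le_imp_le)
  have good: "good_colouring \<Gamma> M (open_graph n (\<lambda>h. X h \<omega>)) (\<lambda>h. w h \<omega>) \<phi>"
    if j: "j \<in> J" "\<phi> \<in> B j" "\<omega> \<in> F j" for j \<phi> \<omega>
  proof -
    obtain a c where ac: "j = (a, c)" "a \<in> A" using j(1) by (auto simp: J_def)
    show ?thesis
    proof (rule embedding_imp_good_colouring[OF \<Gamma>])
      show "inj_on (emb a) (verts \<Gamma>)"
        using emb_inj[OF ac(2)] by (simp add: V_def)
      show "emb a ` verts \<Gamma> \<subseteq> verts (open_graph n (\<lambda>h. X h \<omega>))"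
        using S_sub[OF ac(2)] by (simp add: S_def V_def open_graph_def)
      show "emb a ` e \<in> edges (open_graph n (\<lambda>h. X h \<omega>))" if "e \<in> edges \<Gamma>" for e
        using T_sub[OF ac(2)] that j(3) by (auto simp: open_graph_def F_def ac T_def E_def)
      fix u v assume uv: "{u, v} \<in> edges \<Gamma>"
      have V: "u \<in> V" "v \<in> V" "u \<noteq> v"
        using finite_graph_edgeD(1,2)[OF \<Gamma> uv] by (auto simp: V_def)
      have \<phi>: "\<phi> (emb a x) = c + L * enc x" if "x \<in> V" for x
        using j(2) that div[OF ac(2) that] by (auto simp: B_def ac S_def \<psi>_def)
      \<comment> \<open>Distinct values of \<open>enc\<close> differ by at least 1 and by less than
        \<open>v0\<close>. Along an edge the colour difference is thus at least \<open>L\<close>,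
        which dominates the weight, and at most \<open>L * v0\<close>, hence at most
        \<open>M\<close>.\<close>
      have "\<bar>real (\<phi> (emb a u)) - real (\<phi> (emb a v))\<bar> = real L * \<bar>real (enc u) - real (enc v)\<bar>"
        by (simp add: \<phi>[OF V(1)] \<phi>[OF V(2)] right_diff_distrib[symmetric] abs_mult)
      moreover have "real L * 1 \<le> real L * \<bar>real (enc u) - real (enc v)\<bar>"
      proof (intro mult_left_mono)
        have "enc u \<noteq> enc v" using enc_inj V by (auto simp: inj_on_def)
        then show "1 \<le> \<bar>real (enc u) - real (enc v)\<bar>" by linarith
      qed simp
      moreover have "real L * \<bar>real (enc u) - real (enc v)\<bar> \<le> real L * real v0"
        using enc_less[OF V(1)] enc_less[OF V(2)] by (intro mult_left_mono) auto
      moreover have "w {emb a u, emb a v} \<omega> \<le> real L"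
      proof -
        have "emb a ` {u, v} \<in> T a" using uv by (auto simp only: T_def E_def)
        then show ?thesis using j(3) by (auto simp: F_def ac)
      qed
      ultimately show "w {emb a u, emb a v} \<omega> \<le> \<bar>real (\<phi> (emb a u)) - real (\<phi> (emb a v))\<bar> \<and>
          \<bar>real (\<phi> (emb a u)) - real (\<phi> (emb a v))\<bar> \<le> M"
        using M by (simp add: v0_def V_def)
    qed
  qed
  \<comment> \<open>Colourings whose good copies are all non-special count as bad here; the union of
    \<open>?good\<close> and \<open>?bad\<close> still covers \<open>\<Phi>\<close>, which is enough
    for an upper bound.\<close>
  have le: "real (r ^ n) - real (N_good \<Gamma> M r (open_graph n (\<lambda>h. X h \<omega>)) (\<lambda>h. w h \<omega>))
      \<le> real (card {\<phi>\<in>\<Phi>. \<forall>j\<in>J. \<phi> \<in> B j \<longrightarrow> \<omega> \<notin> F j})" for \<omega>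
  proof -
    let ?good = "{\<phi> \<in> \<Phi>. good_colouring \<Gamma> M (open_graph n (\<lambda>h. X h \<omega>)) (\<lambda>h. w h \<omega>) \<phi>}"
    let ?bad = "{\<phi>\<in>\<Phi>. \<forall>j\<in>J. \<phi> \<in> B j \<longrightarrow> \<omega> \<notin> F j}"
    have "\<Phi> \<subseteq> ?good \<union> ?bad"
    proof
      fix \<phi> assume \<phi>: "\<phi> \<in> \<Phi>"
      show "\<phi> \<in> ?good \<union> ?bad"
      proof (cases "\<exists>j\<in>J. \<phi> \<in> B j \<and> \<omega> \<in> F j")
        case True
        then obtain j where "j \<in> J" "\<phi> \<in> B j" "\<omega> \<in> F j" by blast
        then show ?thesis using good[of j \<phi> \<omega>] \<phi> by simp
      next
        case False
        then show ?thesis using \<phi> by simp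
      qed
    qed
    then have "card \<Phi> \<le> card (?good \<union> ?bad)"
      using fin(1) by (intro card_mono) auto
    also have "\<dots> \<le> card ?good + card ?bad"
      by (rule card_Un_le)
    finally have "real (r ^ n) \<le> real (card ?good) + real (card ?bad)"
      unfolding card\<Phi> by linarith
    then show ?thesis by (simp add: N_good_def open_graph_def \<Phi>_def)
  qed
  have "(\<lambda>\<omega>. real (card {\<phi>\<in>\<Phi>. \<forall>j\<in>J. \<phi> \<in> B j \<longrightarrow> \<omega> \<notin> F j})) \<in> borel_measurable \<Omega>"
  proof -
    have "real (card {\<phi>\<in>\<Phi>. \<forall>j\<in>J. \<phi> \<in> B j \<longrightarrow> \<omega> \<notin> F j}) =
        (\<Sum>\<phi>\<in>\<Phi>. indicator (space \<Omega> - (\<Union>j\<in>{j\<in>J. \<phi> \<in> B j}. F j)) \<omega>)" if "\<omega> \<in> space \<Omega>" for \<omega>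
      using fin(1) that by (simp add: indicator_def sum.If_cases Int_def) (auto intro!: arg_cong[where f = card])
    moreover have "(\<lambda>\<omega>. \<Sum>\<phi>\<in>\<Phi>. indicator (space \<Omega> - (\<Union>j\<in>{j\<in>J. \<phi> \<in> B j}. F j)) \<omega> :: real) \<in> borel_measurable \<Omega>"
      using fin(3) probF(1) by (intro borel_measurable_sum borel_measurable_indicator sets.Diff sets.top sets.finite_UN) auto
    ultimately show ?thesis
      using measurable_cong by (smt (verit, ccfv_SIG))
  qed
  then have "integrable \<Omega> (\<lambda>\<omega>. real (card {\<phi>\<in>\<Phi>. \<forall>j\<in>J. \<phi> \<in> B j \<longrightarrow> \<omega> \<notin> F j}))"
    using fin(1) by (intro integrable_const_bound[where B = "card \<Phi>"]) (auto intro: card_mono)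
  then have "(\<integral>\<omega>. real (r ^ n) - real (N_good \<Gamma> M r (open_graph n (\<lambda>h. X h \<omega>)) (\<lambda>h. w h \<omega>)) \<partial>\<Omega>)
      \<le> expectation (\<lambda>\<omega>. real (card {\<phi>\<in>\<Phi>. \<forall>j\<in>J. \<phi> \<in> B j \<longrightarrow> \<omega> \<notin> F j}))"
    using N_good_integrable[OF we, of \<Gamma> M r] le by (intro integral_mono) auto
  then show ?thesis
    using bad by (simp add: card\<Phi> v0_def V_def)
qed

section \<open>Asymptotics in the number of vertices, and the exponents\<close>

lemma eventually_powr_ge:
  assumes "0 < a"
  shows "\<forall>\<^sub>F n in sequentially. k \<le> real n powr a"
  using eventually_ge_at_top[of "nat \<lceil>\<bar>k\<bar> powr (1 / a)\<rceil>"]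
proof eventually_elim
  case (elim n)
  then have "\<bar>k\<bar> powr (1 / a) \<le> real n"
    by linarith
  then have "(\<bar>k\<bar> powr (1 / a)) powr a \<le> real n powr a"
    using assms by (intro powr_mono2) auto
  then show ?case
    using assms by (simp add: powr_powr)
qed

text \<open>Squaring turns \<open>\<delta> / 4\<close> into \<open>\<delta> / 2\<close>, and the
  other half of the exponent absorbs the constant \<open>k\<close>. The right side has the shape
  asked for by \<open>markov_lower_tail\<close>.\<close>

lemma eventually_powr_le:
  assumes "0 < \<delta>"
  shows "\<forall>\<^sub>F n in sequentially. k * real n powr (- \<delta>) \<le> (1 / real n powr (\<delta> / 4))\<^sup>2"
  using eventually_powr_ge[OF half_gt_zero[OF assms], of k] eventually_gt_at_top[of 0]
proof eventually_elim
  case (elim n)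
  then have "k * real n powr (- \<delta>) \<le> real n powr (\<delta> / 2) * real n powr (- \<delta>)"
    using assms by (intro mult_right_mono) auto
  also have "\<dots> = 1 / real n powr (\<delta> / 2)"
    by (simp add: powr_add[symmetric] powr_minus_divide[symmetric])
  also have "real n powr (\<delta> / 2) = (real n powr (\<delta> / 4))\<^sup>2"
    by (simp add: power2_eq_square powr_add[symmetric])
  also have "1 / (real n powr (\<delta> / 4))\<^sup>2 = (1 / real n powr (\<delta> / 4))\<^sup>2"
    by (simp add: power_divide)
  finally show ?case .
qed

lemma eventually_rounded_powr_bounds:
  assumes "0 < \<theta>" "\<And>n. \<bar>real (r n) - real n powr \<theta>\<bar> < 1"
  shows "\<forall>\<^sub>F n in sequentially. real n powr \<theta> / 2 \<le> real (r n) \<and> real (r n) \<le> 2 * real n powr \<theta>"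
  using eventually_powr_ge[OF assms(1), of 2]
proof eventually_elim
  case (elim n)
  then show ?case using assms(2)[of n] by linarith
qed

text \<open>Continuity from below. The resulting \<open>L\<close> is the weight cutoff of the
  special copies and thereby fixes the threshold for \<open>M\<close>.\<close>

lemma prob_space_atMost_pos:
  assumes "prob_space W" "sets W = sets borel"
  obtains L :: nat where "0 < measure W {..real L}"
proof -
  interpret prob_space W by (rule assms(1))
  have sp: "space W = UNIV"
    using sets_eq_imp_space_eq[OF assms(2)] space_borel by metis
  have "(\<lambda>L. measure W {..real L}) \<longlonglongrightarrow> measure W (\<Union>L. {..real L})"
  proof (rule finite_Lim_measure_incseq)
    show "range (\<lambda>L. {..real L}) \<subseteq> sets W"
      unfolding assms(2) by (intro image_subsetI) simp
    show "incseq (\<lambda>L. {..real L})"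
      by (rule incseq_SucI) simp
  qed
  also have "(\<Union>L. {..real L}) = space W"
    unfolding sp using real_arch_simple by blast
  finally have "(\<lambda>L. measure W {..real L}) \<longlonglongrightarrow> 1"
    by (simp add: prob_space)
  then have "\<forall>\<^sub>F L in sequentially. 0 < measure W {..real L}"
    by (rule order_tendstoD) simp
  then show ?thesis
    using that unfolding eventually_sequentially by blast
qed

text \<open>Balancedness applied to the subgraph induced on \<open>I\<close>, with the denominators
  cleared.\<close>

lemma balanced_induced_edges:
  assumes "finite_graph \<Gamma>" "balanced \<Gamma>" "I \<subseteq> verts \<Gamma>" "I \<noteq> {}"
  shows "real (card {e\<in>edges \<Gamma>. e \<subseteq> I}) * card (verts \<Gamma>) \<le> real (card (edges \<Gamma>)) * card I"
proof -
  have fin: "finite (verts \<Gamma>)"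
    using assms(1) by (simp add: finite_graph_def)
  then have finI: "finite I"
    using assms(3) finite_subset by auto
  have "subgraph (I, {e\<in>edges \<Gamma>. e \<subseteq> I}) \<Gamma>"
    using assms finI by (auto simp: subgraph_def finite_graph_def all_edges_def)
  from assms(2)[unfolded balanced_def, rule_format, of "(I, {e\<in>edges \<Gamma>. e \<subseteq> I})"] this assms(4)
  have "real (card {e\<in>edges \<Gamma>. e \<subseteq> I}) / card I \<le> real (card (edges \<Gamma>)) / card (verts \<Gamma>)"
    by simp
  moreover have "0 < card I" "0 < card (verts \<Gamma>)"
    using assms fin finI by (auto simp: card_gt_0_iff)
  ultimately show ?thesis
    by (simp add: divide_simps mult.commute)
qed

text \<open>The difference of the two sides is affine in \<open>s\<close>, so it suffices to look at \<open>s = 1\<close> and \<open>s = v\<close>.\<close>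

lemma subgraph_exponent_le:
  fixes v e s f \<theta> \<beta> \<delta> :: real
  assumes v: "1 < v" and s: "1 \<le> s" "s \<le> v" and f: "f * v \<le> e * s" and \<beta>: "0 \<le> \<beta>"
    and \<delta>: "\<delta> \<le> 1 - e * \<beta> / v" "\<delta> \<le> v - e * \<beta> - \<theta> * (v - 1)"
  shows "\<theta> * s \<le> - (\<beta> * f) + s + \<theta> - \<delta>"
proof -
  define \<kappa> where "\<kappa> = e * \<beta> / v"
  have "f \<le> e * s / v"
    using f v by (simp add: divide_simps)
  then have "\<beta> * f \<le> \<beta> * (e * s / v)"
    using \<beta> by (rule mult_left_mono)
  also have "\<dots> = \<kappa> * s"
    by (simp add: \<kappa>_def)
  finally have "\<beta> * f \<le> \<kappa> * s" .
  have "\<delta> \<le> 1 - \<kappa>" "\<delta> \<le> v - v * \<kappa> - \<theta> * (v - 1)"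
    using v \<delta> by (simp_all add: \<kappa>_def)
  \<comment> \<open>Interpolation between the endpoints: the weights \<open>v - s\<close> and
    \<open>s - 1\<close> are nonnegative and add up to \<open>v - 1\<close>.\<close>
  then have "(v - s) * \<delta> + (s - 1) * \<delta> \<le> (v - s) * (1 - \<kappa>) + (s - 1) * (v - v * \<kappa> - \<theta> * (v - 1))"
    using s by (intro add_mono mult_left_mono) simp_all
  then have "(v - 1) * \<delta> \<le> (v - 1) * (s - \<kappa> * s - \<theta> * (s - 1))"
    by (simp add: algebra_simps)
  then have "\<delta> \<le> s - \<kappa> * s - \<theta> * (s - 1)"
    using v by simp
  with \<open>\<beta> * f \<le> \<kappa> * s\<close> show ?thesis
    by (simp add: algebra_simps)
qed

section \<open>The two sides of the threshold\<close>

text \<open>With \<open>m\<close> of order \<open>n\<close>, \<open>K\<close> of order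
  \<open>n powr \<theta>\<close> and \<open>\<rho>\<close> a constant times
  \<open>n powr - \<beta>\<close>, the hypothesis \<open>bound\<close> of
  \<open>expectation_N_bad_le\<close> reduces to the exponent inequality
  \<open>subgraph_exponent_le\<close>, up to constants.\<close>

lemma good_colourings_abundant:
  fixes \<Gamma> :: "'b graph" and L :: nat and \<theta> \<beta> :: real
  defines "v0 \<equiv> card (verts \<Gamma>)" and "e0 \<equiv> card (edges \<Gamma>)"
  assumes \<Gamma>: "finite_graph \<Gamma>" "balanced \<Gamma>" "2 \<le> v0"
    and \<theta>: "0 < \<theta>" and \<beta>: "0 \<le> \<beta>" "e0 * \<beta> < v0" and sub: "\<theta> * (real v0 - 1) < v0 - e0 * \<beta>"
    and r: "\<And>n. \<bar>real (r n) - real n powr \<theta>\<bar> < 1"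
    and we: "\<And>n. weighted_edges (\<Omega> n) n (1 / real n powr \<beta>) W (X n) (w n)"
    and q: "0 < measure W {..real L}" and M: "real (L * v0) \<le> M"
  shows "\<exists>C>0. \<forall>\<^sub>F n in sequentially.
    \<P>(\<omega> in \<Omega> n. real (N_good \<Gamma> M (r n) (open_graph n (\<lambda>h. X n h \<omega>)) (\<lambda>h. w n h \<omega>))
      \<ge> real (r n ^ n) * (1 - 1 / real n powr C)) \<ge> 1 - 1 / real n powr C"
proof -
  define q where "q = measure W {..real L}"
  interpret W: prob_space W
    using weighted_edges_law(1)[OF we[of 2]] by simp
  have q01: "0 < q" "q \<le> 1"
    using q by (auto simp: q_def)
  \<comment> \<open>The two entries are the exponent gaps for overlaps in one vertex and in all
    \<open>v0\<close> vertices; the second is positive below the threshold.\<close>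
  define \<delta> where "\<delta> = min (1 - e0 * \<beta> / v0) (v0 - e0 * \<beta> - \<theta> * (real v0 - 1))"
  \<comment> \<open>Collects the losses for an overlap of \<open>s\<close> vertices and
    \<open>f\<close> edges: \<open>2 ^ s\<close> from rounding \<open>r\<close>,
    \<open>(2 * v0) ^ s\<close> from \<open>m\<close>, 4 from \<open>K\<close> and
    \<open>q ^ f\<close> in the denominator, each at its worst for \<open>s = v0\<close> and
    \<open>f = e0\<close>.\<close>
  define c0 where "c0 = 4 * (4 * real v0) ^ v0 / q ^ e0"
  have \<delta>: "0 < \<delta>"
    using \<beta> sub \<Gamma>(3) by (simp add: \<delta>_def)
  have c0: "0 < c0"
    using q01 \<Gamma>(3) by (simp add: c0_def)
  have "\<forall>\<^sub>F n in sequentially.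
    \<P>(\<omega> in \<Omega> n. real (N_good \<Gamma> M (r n) (open_graph n (\<lambda>h. X n h \<omega>)) (\<lambda>h. w n h \<omega>))
      \<ge> real (r n ^ n) * (1 - 1 / real n powr (\<delta> / 4))) \<ge> 1 - 1 / real n powr (\<delta> / 4)"
    using eventually_powr_le[OF \<delta>, of "2 ^ v0 * c0"] eventually_rounded_powr_bounds[OF \<theta> r]
      eventually_powr_ge[OF \<theta>, of "4 * real (L * v0) + 1"] eventually_ge_at_top[of "2 * v0"]
  proof eventually_elim
    case (elim n)
    define x where "x = real n"
    have n: "2 * v0 \<le> n" "2 \<le> n" using elim(4) \<Gamma>(3) by auto
    then have x: "1 \<le> x" by (simp add: x_def)
    note r_bounds = elim(2)[folded x_def]
    define m where "m = n div v0"
    define K where "K = r n - L * v0"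
    define p where "p = 1 / x powr \<beta>"
    define b where "b = c0 * x powr - \<delta>"
    have "real (L * v0) \<le> x powr \<theta> / 4"
      using elim(3) by (simp add: x_def)
    then have "real (L * v0) + x powr \<theta> / 4 \<le> real (r n)"
      using r_bounds by linarith
    moreover have "0 < x powr \<theta>" using x by simp
    ultimately have K: "x powr \<theta> / 4 \<le> real K" "0 < K" "K + L * v0 \<le> r n"
      unfolding K_def by linarith+
    \<comment> \<open>Rounding down loses less than one block length; since \<open>v0\<close> is at
      most half of \<open>n\<close>, at least half of the size survives.\<close>
    have "n < v0 * m + v0"
      using \<Gamma>(3) mult_div_mod_eq[of v0 n] mod_less_divisor[of v0 n] unfolding m_def by linarith
    then have "x < v0 * real m + v0"
      unfolding x_def by (metis of_nat_add of_nat_less_iff of_nat_mult)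
    moreover have "2 * real v0 \<le> x"
      using n(1) unfolding x_def by linarith
    ultimately have "x \<le> 2 * real v0 * real m"
      by linarith
    then have m_ge: "x / (2 * real v0) \<le> real m"
      using \<Gamma>(3) by (simp add: divide_simps mult.commute)
    have m: "0 < m" "v0 * m \<le> n"
      using n \<Gamma>(3) by (auto simp: m_def div_greater_zero_iff)
    have p: "0 < p" "p \<le> 1"
      using x \<beta>(1) ge_one_powr_ge_zero[of x \<beta>] by (auto simp: p_def)
    have "p * q \<le> 1 * 1"
      using p q01 by (intro mult_mono) auto
    have bound: "real (r n) ^ card I \<le> (p * q) ^ card {e\<in>edges \<Gamma>. e \<subseteq> I} * real m ^ card I * (real K * b)"
      if I: "I \<subseteq> verts \<Gamma>" "I \<noteq> {}" for I
    proof -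
      define s where "s = card I"
      define f where "f = card {e\<in>edges \<Gamma>. e \<subseteq> I}"
      have fin: "finite (verts \<Gamma>)" "finite (edges \<Gamma>)"
        using \<Gamma>(1) finite_all_edges[of "verts \<Gamma>"] by (auto simp: finite_graph_def intro: finite_subset)
      have s: "1 \<le> s" "s \<le> v0"
        using I fin finite_subset[OF I(1)] by (auto simp: s_def v0_def card_mono Suc_le_eq card_gt_0_iff)
      have f: "f \<le> e0"
        using fin by (auto simp: f_def e0_def intro: card_mono)
      have expo: "\<theta> * s \<le> - (\<beta> * f) + s + \<theta> - \<delta>"
        using balanced_induced_edges[OF \<Gamma>(1,2) I] s \<Gamma>(3) \<beta>(1)
        by (intro subgraph_exponent_le[where v = v0 and e = e0]) (auto simp: \<delta>_def s_def f_def v0_def e0_def)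
      have "4 * (4 * real v0) ^ s \<le> 4 * (4 * real v0) ^ v0"
        using s \<Gamma>(3) by (intro mult_left_mono power_increasing) auto
      also have "\<dots> = c0 * q ^ e0"
        using q01 by (simp add: c0_def)
      also have "\<dots> \<le> c0 * q ^ f"
        using q01 c0 f by (intro mult_left_mono power_decreasing) auto
      finally have "4 * (4 * real v0) ^ s \<le> c0 * q ^ f" .
      then have "4 * (4 * real v0) ^ s / (4 * (2 * real v0) ^ s) \<le> c0 * q ^ f / (4 * (2 * real v0) ^ s)"
        by (intro divide_right_mono) auto
      moreover have "4 * (4 * real v0) ^ s / (4 * (2 * real v0) ^ s) = 2 ^ s"
        using \<Gamma>(3) by (simp add: power_divide[symmetric])
      ultimately have const: "2 ^ s \<le> q ^ f / (2 * real v0) ^ s / 4 * c0"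
        by (simp add: mult.commute)
      have "real (r n) ^ s \<le> (2 * x powr \<theta>) ^ s"
        using r_bounds by (intro power_mono) auto
      also have "\<dots> = 2 ^ s * x powr (\<theta> * s)"
        using x by (simp add: power_mult_distrib powr_powr[symmetric] powr_realpow)
      also have "\<dots> \<le> (q ^ f / (2 * real v0) ^ s / 4 * c0) * x powr (- (\<beta> * f) + s + \<theta> - \<delta>)"
        using const expo x q01 c0 by (intro mult_mono powr_mono) auto
      also have "x powr (- (\<beta> * f) + s + \<theta> - \<delta>) = x powr (- (\<beta> * f)) * x powr s * x powr \<theta> * x powr - \<delta>"
        by (simp add: powr_add[symmetric])
      also have "x powr (- (\<beta> * f)) = p ^ f"
        using x by (simp add: p_def powr_minus_divide power_divide powr_powr powr_realpow[symmetric])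
      also have "x powr s = x ^ s"
        using x by (simp add: powr_realpow)
      also have "(q ^ f / (2 * real v0) ^ s / 4 * c0) * (p ^ f * x ^ s * x powr \<theta> * x powr - \<delta>)
          = (p * q) ^ f * (x / (2 * real v0)) ^ s * (x powr \<theta> / 4 * b)"
        by (simp add: b_def power_mult_distrib power_divide mult_ac)
      also have "\<dots> \<le> (p * q) ^ f * real m ^ s * (real K * b)"
        using m_ge K(1) p q01 c0 x by (intro mult_mono power_mono) (auto simp: b_def)
      finally show ?thesis by (simp add: s_def f_def)
    qed
    interpret prob_space "\<Omega> n"
      using we[of n] by (simp add: weighted_edges_def)
    let ?Y = "\<lambda>\<omega>. real (r n ^ n) - real (N_good \<Gamma> M (r n) (open_graph n (\<lambda>h. X n h \<omega>)) (\<lambda>h. w n h \<omega>))"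
    have "expectation ?Y \<le> real (r n ^ n) * (2 ^ v0 * b)"
      using p q01 c0 K m M bound \<open>p * q \<le> 1 * 1\<close> unfolding v0_def
      by (intro expectation_N_bad_le[OF we[of n] \<Gamma>(1), where \<rho> = "p * q" and m = m and K = K and L = L])
        (auto simp: p_def q_def x_def b_def)
    also have "\<dots> \<le> real (r n ^ n) * (1 / real n powr (\<delta> / 4))\<^sup>2"
      using elim(1) by (intro mult_left_mono) (auto simp: b_def x_def mult_ac)
    finally have E: "expectation ?Y \<le> real (r n ^ n) * (1 / real n powr (\<delta> / 4))\<^sup>2" .
    have "0 \<le> ?Y \<omega>" for \<omega>
      using N_good_le_N_tot[of "open_graph n (\<lambda>h. X n h \<omega>)" \<Gamma> M "r n" "\<lambda>h. w n h \<omega>"]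
      by (simp add: N_tot_def open_graph_def card_colourings of_nat_power[symmetric] del: of_nat_power)
    moreover have "0 < real (r n ^ n)" using K by simp
    moreover have "integrable (\<Omega> n) ?Y"
      using N_good_integrable[OF we[of n], of \<Gamma> M "r n"] by (intro Bochner_Integration.integrable_diff) auto
    ultimately have "1 - 1 / real n powr (\<delta> / 4) \<le>
        prob {\<omega> \<in> space (\<Omega> n). ?Y \<omega> \<le> real (r n ^ n) * (1 / real n powr (\<delta> / 4))}"
      using E n by (intro markov_lower_tail) auto
    also have "{\<omega> \<in> space (\<Omega> n). ?Y \<omega> \<le> real (r n ^ n) * (1 / real n powr (\<delta> / 4))} =
        {\<omega> \<in> space (\<Omega> n). real (N_good \<Gamma> M (r n) (open_graph n (\<lambda>h. X n h \<omega>)) (\<lambda>h. w n h \<omega>))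
          \<ge> real (r n ^ n) * (1 - 1 / real n powr (\<delta> / 4))}"
      by (intro Collect_cong) (auto simp: right_diff_distrib)
    finally show ?case .
  qed
  then show ?thesis
    using \<delta> by (intro exI[of _ "\<delta> / 4"]) auto
qed

text \<open>The expected proportion of good colourings is a constant times \<open>n powr v0\<close>
  for the embeddings, \<open>n powr - (e0 * \<beta>)\<close> for the edges and
  \<open>n powr - (\<theta> * (v0 - 1))\<close> for the colours; above the threshold the total
  exponent \<open>- \<eta>\<close> is negative.\<close>

lemma good_colourings_rare:
  fixes \<Gamma> :: "'b graph" and \<theta> \<beta> :: real
  defines "v0 \<equiv> card (verts \<Gamma>)" and "e0 \<equiv> card (edges \<Gamma>)"
  assumes \<Gamma>: "finite_graph \<Gamma>" "connected_graph \<Gamma>" "2 \<le> v0"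
    and \<theta>: "0 < \<theta>" and super: "v0 - e0 * \<beta> < \<theta> * (real v0 - 1)"
    and r: "\<And>n. \<bar>real (r n) - real n powr \<theta>\<bar> < 1"
    and we: "\<And>n. weighted_edges (\<Omega> n) n (1 / real n powr \<beta>) W (X n) (w n)"
  shows "\<exists>C>0. \<forall>\<^sub>F n in sequentially.
    \<P>(\<omega> in \<Omega> n. real (N_good \<Gamma> M (r n) (open_graph n (\<lambda>h. X n h \<omega>)) (\<lambda>h. w n h \<omega>))
      \<le> real (r n ^ n) / real n powr C) \<ge> 1 - 1 / real n powr C"
proof -
  have fin: "finite (verts \<Gamma>)" "verts \<Gamma> \<noteq> {}"
    using \<Gamma>(1,2) by (auto simp: finite_graph_def connected_graph_def)
  obtain D :: nat where D: "\<And>c :: 'b \<Rightarrow> real. \<forall>u v. {u, v} \<in> edges \<Gamma> \<longrightarrow> \<bar>c u - c v\<bar> \<le> M \<Longrightarrow>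
      \<forall>u\<in>verts \<Gamma>. \<forall>v\<in>verts \<Gamma>. \<bar>c u - c v\<bar> \<le> real D"
    using connected_graph_oscillation[OF \<Gamma>(2) fin(1)] by blast
  define \<eta> where "\<eta> = \<theta> * (real v0 - 1) - (v0 - e0 * \<beta>)"
  \<comment> \<open>The first factor comes from the colour windows, the second from
    \<open>r n\<close> being at least half of \<open>n powr \<theta>\<close> in
    \<open>v0 - 1\<close> denominators.\<close>
  define c0 where "c0 = (2 * real D + 1) ^ v0 * 2 ^ (v0 - 1)"
  have \<eta>: "0 < \<eta>" using super by (simp add: \<eta>_def)
  have "\<forall>\<^sub>F n in sequentially.
    \<P>(\<omega> in \<Omega> n. real (N_good \<Gamma> M (r n) (open_graph n (\<lambda>h. X n h \<omega>)) (\<lambda>h. w n h \<omega>))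
      \<le> real (r n ^ n) / real n powr (\<eta> / 4)) \<ge> 1 - 1 / real n powr (\<eta> / 4)"
    using eventually_powr_le[OF \<eta>, of c0] eventually_rounded_powr_bounds[OF \<theta> r]
      eventually_ge_at_top[of v0]
  proof eventually_elim
    case (elim n)
    define x where "x = real n"
    have n: "v0 \<le> n" "2 \<le> n" using elim(3) \<Gamma>(3) by auto
    then have x: "1 \<le> x" by (simp add: x_def)
    note r_bounds = elim(2)[folded x_def]
    define p where "p = 1 / x powr \<beta>"
    have "0 < x powr \<theta>" using x by simp
    then have r_pos: "0 < real (r n)" using r_bounds by linarith
    interpret prob_space "\<Omega> n"
      using we[of n] by (simp add: weighted_edges_def)
    let ?Y = "\<lambda>\<omega>. real (N_good \<Gamma> M (r n) (open_graph n (\<lambda>h. X n h \<omega>)) (\<lambda>h. w n h \<omega>))"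
    have "expectation ?Y \<le> x ^ v0 * (real (r n) * ((2 * real D + 1) ^ v0 * real (r n) ^ (n - v0))) * p ^ e0"
      unfolding v0_def e0_def x_def p_def
      by (rule expectation_N_good_le[OF we \<Gamma>(1) fin(2) n(2) _ D]) auto
    also have "\<dots> = (real (r n) * real (r n) ^ (n - v0)) * ((2 * real D + 1) ^ v0 * (x ^ v0 * p ^ e0))"
      by (simp add: mult_ac)
    \<comment> \<open>One colour of the cluster is free, so only \<open>v0 - 1\<close> factors of
      \<open>r n\<close> are lost; \<open>v0 \<le> n\<close> keeps the truncated subtraction
      exact.\<close>
    also have "real (r n) * real (r n) ^ (n - v0) = real (r n) ^ n * (1 / real (r n) ^ (v0 - 1))"
    proof -
      have "n = Suc (n - v0) + (v0 - 1)" using n \<Gamma>(3) by simp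
      then have "real (r n) ^ n = real (r n) ^ Suc (n - v0) * real (r n) ^ (v0 - 1)"
        by (metis power_add)
      then show ?thesis using r_pos by simp
    qed
    also have "real (r n) ^ n * (1 / real (r n) ^ (v0 - 1)) * ((2 * real D + 1) ^ v0 * (x ^ v0 * p ^ e0))
        \<le> real (r n) ^ n * (2 ^ (v0 - 1) * x powr (- (\<theta> * (real v0 - 1)))) * ((2 * real D + 1) ^ v0 * (x ^ v0 * p ^ e0))"
    proof (intro mult_right_mono mult_left_mono)
      have "(x powr \<theta> / 2) ^ (v0 - 1) \<le> real (r n) ^ (v0 - 1)"
        using r_bounds by (intro power_mono) auto
      then have "1 / real (r n) ^ (v0 - 1) \<le> 1 / (x powr \<theta> / 2) ^ (v0 - 1)"
        using x r_pos by (intro divide_left_mono mult_pos_pos) auto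
      also have "\<dots> = 2 ^ (v0 - 1) * (1 / (x powr \<theta>) ^ (v0 - 1))"
        by (simp add: power_divide)
      also have "(x powr \<theta>) ^ (v0 - 1) = x powr (\<theta> * (real v0 - 1))"
        using x \<Gamma>(3) by (simp add: powr_powr[symmetric] powr_realpow[symmetric] of_nat_diff)
      finally show "1 / real (r n) ^ (v0 - 1) \<le> 2 ^ (v0 - 1) * x powr (- (\<theta> * (real v0 - 1)))"
        by (simp add: powr_minus_divide)
    qed (use x in \<open>auto simp: p_def\<close>)
    also have "p ^ e0 = x powr (- (e0 * \<beta>))"
      using x by (simp add: p_def powr_minus_divide power_divide powr_powr powr_realpow[symmetric] mult.commute)
    also have "x ^ v0 = x powr v0"
      using x by (simp add: powr_realpow)
    also have "real (r n) ^ n * (2 ^ (v0 - 1) * x powr (- (\<theta> * (real v0 - 1)))) *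
        ((2 * real D + 1) ^ v0 * (x powr v0 * x powr (- (e0 * \<beta>))))
        = real (r n) ^ n * (c0 * (x powr (- (\<theta> * (real v0 - 1))) * x powr v0 * x powr (- (e0 * \<beta>))))"
      by (simp add: c0_def mult_ac)
    also have "x powr (- (\<theta> * (real v0 - 1))) * x powr v0 * x powr (- (e0 * \<beta>)) = x powr - \<eta>"
      by (simp add: powr_add[symmetric] \<eta>_def algebra_simps)
    also have "real (r n) ^ n * (c0 * x powr - \<eta>) \<le> real (r n) ^ n * (1 / x powr (\<eta> / 4))\<^sup>2"
      using elim(1) by (intro mult_left_mono) (auto simp: x_def)
    finally have E: "expectation ?Y \<le> real (r n ^ n) * (1 / real n powr (\<eta> / 4))\<^sup>2"
      by (simp add: x_def)
    have "1 - 1 / real n powr (\<eta> / 4) \<le>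
        prob {\<omega> \<in> space (\<Omega> n). ?Y \<omega> \<le> real (r n ^ n) * (1 / real n powr (\<eta> / 4))}"
      using E n r_pos N_good_integrable[OF we[of n], of \<Gamma> M "r n"] by (intro markov_lower_tail) auto
    then show ?case by simp
  qed
  then show ?thesis
    using \<eta> by (intro exI[of _ "\<eta> / 4"]) auto
qed

theorem theorem2:
  fixes \<Gamma> :: "'b graph"
    and v0 e0 :: nat
    and \<theta> \<beta> \<theta>th :: real
    and r :: "nat \<Rightarrow> nat"
    and \<Omega> :: "nat \<Rightarrow> 's measure"
    and W :: "real measure"
    and X w :: "nat \<Rightarrow> nat set \<Rightarrow> 's \<Rightarrow> real"
    and G :: "nat \<Rightarrow> 's \<Rightarrow> nat graph"
  assumes "finite_graph \<Gamma>" and "balanced \<Gamma>"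
    and "card (verts \<Gamma>) = v0" and "card (edges \<Gamma>) = e0"
    and "0 < \<theta>" and "\<theta> < 1"
    and "1 / real e0 < \<beta>" and "\<beta> < real v0 / real e0"
    and "\<theta>th = (real v0 - real e0 * \<beta>) / (real v0 - 1)"
    and "\<And>n. \<bar>real (r n) - real n powr \<theta>\<bar> < 1"
    and "\<And>n. weighted_edges (\<Omega> n) n (1 / real n powr \<beta>) W (X n) (w n)"
    and "\<And>n \<omega>. G n \<omega> = open_graph n (\<lambda>h. X n h \<omega>)"
  shows "0 < \<theta>th \<and> \<theta>th < 1 \<and>
    (\<exists>M0>0. \<forall>M>M0.
      (\<theta> < \<theta>th \<longrightarrow>
        (\<exists>C1>0. \<exists>C2>0. \<forall>\<^sub>F n in sequentially.
          \<P>(\<omega> in \<Omega> n. real (N_good \<Gamma> M (r n) (G n \<omega>) (\<lambda>h. w n h \<omega>))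
              \<ge> real (N_tot (G n \<omega>) (r n)) * (1 - 1 / real n powr C1))
          \<ge> 1 - 1 / real n powr C2)) \<and>
      (connected_graph \<Gamma> \<longrightarrow> \<theta> > \<theta>th \<longrightarrow>
        (\<exists>D1>0. \<exists>D2>0. \<forall>\<^sub>F n in sequentially.
          \<P>(\<omega> in \<Omega> n. real (N_good \<Gamma> M (r n) (G n \<omega>) (\<lambda>h. w n h \<omega>))
              \<le> real (N_tot (G n \<omega>) (r n)) / real n powr D1)
          \<ge> 1 - 1 / real n powr D2)))"
proof -
  \<comment> \<open>For \<open>e0 = 0\<close> both bounds on \<open>\<beta>\<close> would read 0, as
    division by zero gives zero, and the interval would be empty.\<close>
  have e0: "0 < e0"
    using assms(7,8) by (cases "e0 = 0") auto
  \<comment> \<open>The first inequality yields \<open>\<theta>th < 1\<close>, the second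
    \<open>0 < \<theta>th\<close>; together they force \<open>v0\<close> to be at least 2.\<close>
  then have \<beta>: "1 < e0 * \<beta>" "e0 * \<beta> < v0"
    using assms(7,8) by (simp_all add: divide_simps mult.commute)
  then have v0: "2 \<le> v0"
    by linarith
  have \<beta>0: "0 \<le> \<beta>"
    using assms(7) by (meson divide_nonneg_nonneg less_le_not_le linear of_nat_0_le_iff order_trans zero_le_one)
  have th: "0 < \<theta>th" "\<theta>th < 1"
    using \<beta> v0 unfolding assms(9) by (auto simp: divide_simps)
  have tot: "real (N_tot (open_graph n (\<lambda>h. X n h \<omega>)) (r n)) = real (r n ^ n)" for n \<omega>
    by (simp add: N_tot_def open_graph_def card_colourings)
  obtain L :: nat where L: "0 < measure W {..real L}"
    using prob_space_atMost_pos[OF weighted_edges_law[OF assms(11)[of 2]]] by auto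
  have "\<exists>C1>0. \<exists>C2>0. \<forall>\<^sub>F n in sequentially.
          \<P>(\<omega> in \<Omega> n. real (N_good \<Gamma> M (r n) (G n \<omega>) (\<lambda>h. w n h \<omega>))
              \<ge> real (N_tot (G n \<omega>) (r n)) * (1 - 1 / real n powr C1))
          \<ge> 1 - 1 / real n powr C2"
    if M: "real (L * v0) + 1 < M" and \<theta>: "\<theta> < \<theta>th" for M
  proof -
    have "\<theta> * (real v0 - 1) < v0 - e0 * \<beta>"
      using \<theta> v0 unfolding assms(9) by (simp add: less_divide_eq)
    moreover have "real (L * v0) \<le> M" using M by linarith
    ultimately show ?thesis
      unfolding assms(12) tot
      using good_colourings_abundant[OF assms(1,2), unfolded assms(3,4), OF v0 assms(5) \<beta>0 \<beta>(2) _ assms(10) assms(11) L]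
      by blast
  qed
  moreover have "\<exists>D1>0. \<exists>D2>0. \<forall>\<^sub>F n in sequentially.
          \<P>(\<omega> in \<Omega> n. real (N_good \<Gamma> M (r n) (G n \<omega>) (\<lambda>h. w n h \<omega>))
              \<le> real (N_tot (G n \<omega>) (r n)) / real n powr D1)
          \<ge> 1 - 1 / real n powr D2"
    if conn: "connected_graph \<Gamma>" and \<theta>: "\<theta>th < \<theta>" for M
  proof -
    have "v0 - e0 * \<beta> < \<theta> * (real v0 - 1)"
      using \<theta> v0 unfolding assms(9) by (simp add: divide_less_eq)
    then show ?thesis
      unfolding assms(12) tot
      using good_colourings_rare[OF assms(1) conn, unfolded assms(3,4), OF v0 assms(5) _ assms(10) assms(11)]
      by blast
  qed
  \<comment> \<open>\<open>M0\<close> exceeds the largest colour difference allowed in a special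
    copy; adding 1 makes its positivity immediate.\<close>
  ultimately show ?thesis
    using th by (intro conjI exI[of _ "real (L * v0) + 1"]) (auto intro: add_nonneg_pos)
qed

end
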